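(* Let $H$ be a Krull monoid having a cyclic class group $G$ of order $|G|=n\ge 5$. 1. If $n=p$ is prime, then $$\mathsf t(H)\le 1+\frac{2(p-1)p}{p+5}+2(p-1)\Big(\frac12+\log\Big(\frac{p+3}{2}\Big)\Big).$$ 2. If $n=p^\alpha$ with $p$ prime and $\alpha\ge2$, then $$\mathsf t(H)\le 1-2\alpha+\frac{2p^{\alpha+1}}{p-1}+2\alpha n+3\sum_{i=1}^{\alpha}(p^i-1)\log\frac{p^i}{2}.$$ 3. If $n=p_1^{\alpha_1}\cdots p_r^{\alpha_r}$, where $r\ge2$, $\alpha_1,\dots,\alpha_r\in\mathbb N$, and $p_1,\dots,p_r$ are distinct primes, then $$\mathsf t(H)\le 1+\frac{4.3}{2}\sum_{1<d\mid n}(d-1)+n\sum_{1<d\mid n,\ d\le4375}\frac d2+n\sum_{4376\le d\mid n}2^{\omega(d)+1}\sqrt{2\omega(d)}+3.3\sum_{4376\le d\mid n}(d-1)\log\Big(\Big\lfloor\frac{d+1}{2^{\omega(d)+1}\sqrt{2\omega(d)-1}+1}-1\Big\rfloor\Big).$$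
   Context: $\mathbb N=\{1,2,\dots\}$, $\mathbb N_0=\mathbb N\cup\{0\}$; $\log$ is the natural logarithm; $\omega(d)$ is the number of distinct prime divisors of $d\in\mathbb N$; sums over $d\mid n$ run over positive divisors $d$ of $n$ satisfying the indicated inequalities. A monoid is a commutative cancellative semigroup with identity. For a monoid $H$: $H^\times$ is its group of units, $H_{\rm red}=\{aH^\times: a\in H\}$, $\mathcal A(H)$ its set of atoms (irreducible elements), $\mathsf q(H)$ its quotient group. $\mathcal F(P)$ is the free abelian monoid with basis $P$; for $a=\prod_{p\in P}p^{\mathsf v_p(a)}\in\mathcal F(P)$ put $|a|=\sum_p\mathsf v_p(a)$. Factorizations and tame degree: $\mathsf Z(H)=\mathcal F(\mathcal A(H_{\rm red}))$, $\pi:\mathsf Z(H)\to H_{\rm red}$ is the homomorphism with $\pi(u)=u$ on atoms, $\mathsf Z(a)=\pi^{-1}(aH^\times)$ for $a\in H$. For $z,z'\in\mathsf Z(H)$, $\mathsf d(z,z')=\max\{|z\gcd(z,z')^{-1}|,|z'\gcd(z,z')^{-1}|\}$. For $a\in H$ and $x\in\mathsf Z(H)$, $\mathsf t(a,x)\in\mathbb N_0\cup\{\infty\}$ is the smallest $N$ such that: if $\mathsf Z(a)\cap x\mathsf Z(H)\neq\emptyset$ and $z\in\mathsf Z(a)$, then there is $z'\in\mathsf Z(a)\cap x\mathsf Z(H)$ with $\mathsf d(z,z')\le N$. $\mathsf t(H,u)=\sup_{a\in H}\mathsf t(a,u)$ for $u\in\mathcal A(H_{\rm red})$, and $\mathsf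 t(H)=\sup\{\mathsf t(H,u):u\in\mathcal A(H_{\rm red})\}$ is the tame degree of $H$. Krull monoids: a monoid homomorphism $\varphi:H\to D$ is a divisor homomorphism if $\varphi(a)\mid\varphi(b)$ implies $a\mid b$. It is a divisor theory if $D=\mathcal F(P)$ for a set $P$, $\varphi$ is a divisor homomorphism, and each $p\in P$ equals $\gcd(\varphi(X))$ for some finite nonempty $X\subset H$. $H$ is a Krull monoid if it has a divisor theory $\varphi:H\to\mathcal F(P)$; this is essentially unique, and $G=\mathsf q(\mathcal F(P))/\mathsf q(\varphi(H))$ is the class group of $H$. *)

theory Defs
  imports
    Complex_Main
    "HOL-Algebra.Divisibility"
    "HOL-Algebra.Free_Abelian_Groups"
    "HOL-Library.Multiset"
    "HOL-Library.Extended_Real"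
    "HOL-Computational_Algebra.Primes"
begin

section \<open>Monoids and factorizations\<close>

text \<open>Monoids in the sense of factorization theory are structures satisfying the predicate
  \<^locale>\<open>comm_monoid_cancel\<close>. The free abelian monoid with basis \<open>P\<close> consists of the finite
  multisets over \<open>P\<close>, so the exponent of \<open>p\<close> in \<open>z\<close> is \<open>count z p\<close>, the length of \<open>z\<close> is
  \<open>size z\<close>, and the gcd of \<open>z\<close> and \<open>z'\<close> is \<open>z \<inter># z'\<close>.\<close>

definition free_abelian_monoid :: "'p set \<Rightarrow> 'p multiset monoid" where
  "free_abelian_monoid P = \<lparr>carrier = {m. set_mset m \<subseteq> P}, mult = (+), one = {#}\<rparr>"

definition reduced_monoid :: "('a, 'b) monoid_scheme \<Rightarrow> 'a set monoid" where
  "reduced_monoid H =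
     \<lparr>carrier = {a <#\<^bsub>H\<^esub> Units H | a. a \<in> carrier H}, mult = set_mult H, one = Units H\<rparr>"

definition atoms :: "('a, 'b) monoid_scheme \<Rightarrow> 'a set" where
  "atoms H = {u \<in> carrier H. Divisibility.irreducible H u}"

definition factorization_monoid :: "('a, 'b) monoid_scheme \<Rightarrow> 'a set multiset monoid" where
  "factorization_monoid H = free_abelian_monoid (atoms (reduced_monoid H))"

definition factorization_hom :: "('a, 'b) monoid_scheme \<Rightarrow> 'a set multiset \<Rightarrow> 'a set" where
  "factorization_hom H z =
     (\<Otimes>\<^bsub>reduced_monoid H\<^esub>u\<in>set_mset z. u [^]\<^bsub>reduced_monoid H\<^esub> count z u)"

definition factorizations :: "('a, 'b) monoid_scheme \<Rightarrow> 'a \<Rightarrow> 'a set multiset set" where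
  "factorizations H a =
     {z \<in> carrier (factorization_monoid H). factorization_hom H z = a <#\<^bsub>H\<^esub> Units H}"

definition factorization_distance :: "'u multiset \<Rightarrow> 'u multiset \<Rightarrow> nat" where
  "factorization_distance z z' = max (size (z - z \<inter># z')) (size (z' - z \<inter># z'))"

section \<open>Tame degree\<close>

text \<open>The least element is taken in \<^typ>\<open>enat\<close>, where \<open>\<infinity>\<close> always satisfies the condition.\<close>

definition local_tame_degree :: "('a, 'b) monoid_scheme \<Rightarrow> 'a \<Rightarrow> 'a set multiset \<Rightarrow> enat" where
  "local_tame_degree H a x =
     (let Zx = factorizations H a \<inter>
                 (x <#\<^bsub>factorization_monoid H\<^esub> carrier (factorization_monoid H))
      in LEAST N. Zx \<noteq> {} \<longrightarrow>
           (\<forall>z\<in>factorizations H a. \<exists>z'\<in>Zx. enat (factorization_distance z z') \<le> N))"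

definition atom_tame_degree :: "('a, 'b) monoid_scheme \<Rightarrow> 'a set \<Rightarrow> enat" where
  "atom_tame_degree H u = (SUP a\<in>carrier H. local_tame_degree H a {#u#})"

definition tame_degree :: "('a, 'b) monoid_scheme \<Rightarrow> enat" where
  "tame_degree H = (SUP u\<in>atoms (reduced_monoid H). atom_tame_degree H u)"

section \<open>Krull monoids and class groups\<close>

definition divisor_homomorphism ::
    "('a, 'b) monoid_scheme \<Rightarrow> ('c, 'd) monoid_scheme \<Rightarrow> ('a \<Rightarrow> 'c) \<Rightarrow> bool" where
  "divisor_homomorphism H D \<phi> \<longleftrightarrow>
     \<phi> \<in> hom H D \<and> \<phi> \<one>\<^bsub>H\<^esub> = \<one>\<^bsub>D\<^esub> \<and>
     (\<forall>a\<in>carrier H. \<forall>b\<in>carrier H. \<phi> a divides\<^bsub>D\<^esub> \<phi> b \<longrightarrow> a divides\<^bsub>H\<^esub> b)"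

text \<open>The last clause says \<open>p = gcd (\<phi> ` X)\<close>: being reduced, the free abelian monoid has at most
  one greatest common divisor of a given set.\<close>

definition divisor_theory ::
    "('a, 'b) monoid_scheme \<Rightarrow> 'p set \<Rightarrow> ('a \<Rightarrow> 'p multiset) \<Rightarrow> bool" where
  "divisor_theory H P \<phi> \<longleftrightarrow>
     divisor_homomorphism H (free_abelian_monoid P) \<phi> \<and>
     (\<forall>p\<in>P. \<exists>X. finite X \<and> X \<noteq> {} \<and> X \<subseteq> carrier H \<and>
        greatest (division_rel (free_abelian_monoid P)) {#p#}
          (Lower (division_rel (free_abelian_monoid P)) (\<phi> ` X)))"

text \<open>The divisor theory is a parameter because HOL cannot quantify existentially over the type
  of its primes; statements about Krull monoids are to be read for arbitrary \<open>P\<close> and \<open>\<phi>\<close>.\<close>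

locale krull_monoid = comm_monoid_cancel H
  for H :: "('a, 'b) monoid_scheme" (structure) +
  fixes P :: "'p set" and \<phi> :: "'a \<Rightarrow> 'p multiset"
  assumes divisor_theory: "divisor_theory H P \<phi>"

text \<open>The quotient group of the free abelian monoid with basis \<open>P\<close> is realized, additively, as the
  free abelian group on \<open>P\<close>, into which the monoid embeds by the following map.\<close>

definition frag_of_mset :: "'p multiset \<Rightarrow> 'p \<Rightarrow>\<^sub>0 int" where
  "frag_of_mset m = (\<Sum>p\<in>#m. frag_of p)"

definition class_group ::
    "('a, 'b) monoid_scheme \<Rightarrow> 'p set \<Rightarrow> ('a \<Rightarrow> 'p multiset) \<Rightarrow> ('p \<Rightarrow>\<^sub>0 int) set monoid" where
  "class_group H P \<phi> =
     free_Abelian_group P Mod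
       {frag_of_mset (\<phi> a) - frag_of_mset (\<phi> b) | a b. a \<in> carrier H \<and> b \<in> carrier H}"

definition num_prime_divisors :: "nat \<Rightarrow> nat" where
  "num_prime_divisors d = card (prime_factors d)"

end

theory Submission
  imports Defs "HOL-Algebra.Multiplicative_Group"
begin

text \<open>
  The divisor theory \<open>\<phi>\<close> turns the problem into one about zero-sum multisets of residues. A coset
  \<open>aH\<^sup>\<times>\<close> is the same thing as the multiset \<open>\<phi> a\<close> of primes. Writing \<open>\<kappa> p \<in> {0..<n}\<close> for the class
  of the prime \<open>p\<close>, a multiset of primes lies in \<open>\<phi>(H)\<close> iff its classes sum to \<open>0\<close> modulo \<open>n\<close>. So
  the atoms of \<open>H\<close> are the minimal zero-sum multisets; as \<open>n\<close> residues always contain a nonempty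
  zero-sum part, each atom consists of at most \<open>n\<close> primes.

  Let \<open>z\<close> be a factorization of \<open>a\<close> and \<open>u\<close> an atom dividing \<open>a\<close>. Each of the at most \<open>n\<close> primes of \<open>u\<close>
  is contained in an atom of \<open>z\<close>, so \<open>u\<close> divides the product of a set \<open>I\<close> of at most \<open>n\<close> atoms of \<open>z\<close>.
  Replacing these atoms by \<open>u\<close> and by a factorization of the quotient \<open>V\<close> into \<open>k\<close> atoms gives a
  factorization that contains \<open>u\<close>, at distance at most \<open>max |I| (1 + k)\<close> from \<open>z\<close>. What remains is to
  factor \<open>V\<close> into few, hence long, atoms (\<open>exchange_factorization\<close>, \<open>tame_degree_bound\<close>).

  The decisive step is \<open>long_minimal_zero_sum\<close>: if \<open>S\<close> consists of residues of order \<open>d\<close>, none of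
  which occurs \<open>d\<close> times, and \<open>|S| > (h - 1)(d - 1)\<close> with \<open>h \<ge> 3\<close>, then \<open>S\<close> contains a minimal zero-sum multiset of length at least \<open>h/2\<close>. To see
  this, take an element \<open>g\<close> of largest multiplicity \<open>M \<ge> h\<close>, and extend \<open>g\<^sup>M\<close> inside \<open>S\<close> to a maximal
  zero-sum free multiset \<open>g\<^sup>M R'\<close>; it has at most \<open>d - 1\<close> elements. Every other element \<open>x\<close> of \<open>S\<close>
  completes a part of \<open>g\<^sup>M R'\<close> to a zero-sum multiset, which is automatically minimal. If all of these
  are short, then each way to write \<open>-x\<close> as \<open>\<sigma>(T) + ig\<close> with \<open>T \<subseteq> R'\<close> and \<open>i \<le> M\<close> has a small \<open>i\<close>, and
  \<open>card_escaping_sums\<close> shows that only few residues \<open>x\<close> have this property. None of them occurs more than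
  \<open>M\<close> times, which contradicts the size of \<open>S\<close>.

  Now remove long atoms greedily from the part of \<open>V\<close> that consists of residues of order \<open>d\<close>. As long as
  more than \<open>(d - 1)\<^sup>2\<close> of them are left, one occurs \<open>d\<close> times and gives an atom of length \<open>d\<close>; later,
  when \<open>s\<close> elements are left, an atom of length at least \<open>s/(2(d - 1))\<close> is available. Summing a
  harmonic series, this costs at most \<open>n + (d - 1)(1 + 2 ln (d/2))\<close> atoms, since \<open>V\<close> contains at most \<open>nd\<close>
  residues of order \<open>d\<close>. The leftovers of all orders together form a zero-sum multiset and are
  factored arbitrarily, into atoms of length at least \<open>2\<close>. Altogether
  \<open>t(H) \<le> 1 + (\<Sum>1 < d | n. min (nd/2) (n + (d - 1)(1 + 2 ln (d/2))))\<close>,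
  and the three estimates of the theorem are upper bounds for the right-hand side.
\<close>

section \<open>Zero-sum multisets of residues\<close>

definition zero_sum :: "nat \<Rightarrow> int multiset \<Rightarrow> bool" where
  "zero_sum n M \<longleftrightarrow> int n dvd \<Sum>\<^sub># M"

definition minimal_zero_sum :: "nat \<Rightarrow> int multiset \<Rightarrow> bool" where
  "minimal_zero_sum n M \<longleftrightarrow>
     M \<noteq> {#} \<and> zero_sum n M \<and> (\<forall>T. T \<subseteq># M \<longrightarrow> zero_sum n T \<longrightarrow> T = {#} \<or> T = M)"

definition torsion :: "nat \<Rightarrow> nat \<Rightarrow> int set" where
  "torsion n d = {x. 0 \<le> x \<and> x < int n \<and> int n dvd int d * x}"

text \<open>The order of \<open>x\<close> in \<open>\<int>/n\<close> is \<open>n / gcd x n\<close>.\<close>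

definition residues_of_order :: "nat \<Rightarrow> nat \<Rightarrow> int set" where
  "residues_of_order n d = {x. 0 \<le> x \<and> x < int n \<and> gcd x (int n) * int d = int n}"

lemma zero_sum_empty [simp]: "zero_sum n {#}"
  by (simp add: zero_sum_def)

lemma zero_sum_union: "zero_sum n A \<Longrightarrow> zero_sum n B \<Longrightarrow> zero_sum n (A + B)"
  by (simp add: zero_sum_def)

lemma zero_sum_union_iff: "zero_sum n A \<Longrightarrow> zero_sum n (A + B) \<longleftrightarrow> zero_sum n B"
  by (simp add: zero_sum_def dvd_add_right_iff)

lemma zero_sum_diff: "zero_sum n A \<Longrightarrow> B \<subseteq># A \<Longrightarrow> zero_sum n B \<Longrightarrow> zero_sum n (A - B)"
  by (metis subset_mset.add_diff_inverse zero_sum_union_iff)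

lemma finite_torsion: "finite (torsion n d)"
  by (rule finite_subset[of _ "{0..<int n}"]) (auto simp: torsion_def)

lemma card_torsion:
  assumes "d dvd n" "n > 0"
  shows "card (torsion n d) = d"
proof -
  obtain k where k: "n = d * k" using assms by blast
  have d: "d > 0" and kp: "k > 0" using k assms by auto
  have "torsion n d = (\<lambda>i. i * int k) ` {0..<int d}"
  proof (intro Set.set_eqI iffI)
    fix x assume x: "x \<in> torsion n d"
    hence "int k dvd x" using d k by (auto simp: torsion_def)
    then obtain y where "x = y * int k" by (metis dvdE mult.commute)
    moreover have "0 \<le> y" "y < int d"
      using x kp k calculation by (auto simp: torsion_def zero_le_mult_iff mult_less_cancel_right)
    ultimately show "x \<in> (\<lambda>i. i * int k) ` {0..<int d}" by auto
  next
    fix x assume "x \<in> (\<lambda>i. i * int k) ` {0..<int d}"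
    thus "x \<in> torsion n d" using kp k by (auto simp: torsion_def)
  qed
  moreover have "inj_on (\<lambda>i. i * int k) {0..<int d}" using kp by (auto intro: inj_onI)
  ultimately show ?thesis by (simp add: card_image)
qed

lemma mod_in_torsion:
  assumes "n > 0" "int n dvd int d * x"
  shows "x mod int n \<in> torsion n d"
proof -
  have "int n dvd int d * (x - x mod int n)" by (simp add: minus_mod_eq_mult_div)
  hence "int n dvd int d * x - int d * (x - x mod int n)" using assms(2) by (rule dvd_diff[rotated])
  thus ?thesis using assms(1) by (simp add: torsion_def algebra_simps)
qed

lemma residues_of_order_dvd_iff:
  assumes "x \<in> residues_of_order n d" "n > 0"
  shows "int n dvd t * x \<longleftrightarrow> int d dvd t"
proof -
  define g where "g = gcd x (int n)"
  have g: "g > 0" "int n = g * int d" using assms by (auto simp: residues_of_order_def g_def)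
  obtain y where y: "x = g * y" unfolding g_def by (metis dvdE gcd_dvd1)
  have "g * gcd y (int d) = gcd (g * y) (g * int d)"
    using g(1) by (simp add: gcd_mult_left abs_mult)
  also have "\<dots> = g" unfolding g_def using y g(2) g_def by metis
  finally have "coprime y (int d)" using g(1) by (simp add: coprime_iff_gcd_eq_1)
  moreover have "int n dvd t * x \<longleftrightarrow> int d dvd t * y"
    using g by (simp add: y algebra_simps)
  ultimately show ?thesis by (simp add: coprime_dvd_mult_left_iff coprime_commute)
qed

lemma residues_of_order_torsion: "n > 0 \<Longrightarrow> residues_of_order n d \<subseteq> torsion n d"
  using residues_of_order_dvd_iff[of _ n d "int d"] by (auto simp: torsion_def residues_of_order_def)

lemma residues_of_order_nonzero:
  assumes "d \<ge> 2" "n > 0" "x \<in> residues_of_order n d"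
  shows "x \<noteq> 0"
  using assms by (auto simp: residues_of_order_def)

lemma sum_mset_torsion:
  assumes "set_mset M \<subseteq> torsion n d"
  shows "int n dvd int d * \<Sum>\<^sub># M"
  using assms by (induction M) (auto simp: torsion_def algebra_simps)

text \<open>Two of the \<open>d + 1\<close> partial sums of the first \<open>d\<close> elements agree modulo \<open>n\<close>, because they lie in the
  subgroup of elements killed by \<open>d\<close>; the segment between them has sum zero.\<close>

lemma short_zero_sum:
  assumes "d dvd n" "n > 0" "set_mset M \<subseteq> torsion n d" "size M \<ge> d"
  obtains T where "T \<subseteq># M" "T \<noteq> {#}" "zero_sum n T" "size T \<le> d"
proof -
  obtain xs where xs: "mset xs = M" using ex_mset by blast
  define f where "f i = sum_list (take i xs) mod int n" for i
  have "f ` {0..d} \<subseteq> torsion n d"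
  proof safe
    fix i assume "i \<in> {0..d}"
    have "set (take i xs) \<subseteq> set_mset M" using xs set_take_subset by fastforce
    hence "set_mset (mset (take i xs)) \<subseteq> torsion n d" using assms(3) by auto
    hence "int n dvd int d * sum_list (take i xs)" using sum_mset_torsion by (metis sum_mset_sum_list)
    thus "f i \<in> torsion n d" unfolding f_def using assms(2) mod_in_torsion by blast
  qed
  hence "card (f ` {0..d}) \<le> d" using card_mono[OF finite_torsion] card_torsion assms by metis
  hence "\<not> inj_on f {0..d}" using card_image by fastforce
  then obtain i j where ij: "i < j" "j \<le> d" "f i = f j"
    unfolding inj_on_def by (metis atLeastAtMost_iff linorder_neqE_nat)
  define T where "T = mset (drop i (take j xs))"
  have sp: "take j xs = take i xs @ drop i (take j xs)"
    using ij(1) by (metis append_take_drop_id less_imp_le min.absorb1 take_take)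
  have len: "length xs \<ge> d" using assms(4) xs by auto
  have "sum_list (take j xs) = sum_list (take i xs) + \<Sum>\<^sub># T"
    using sp by (metis T_def sum_list_append sum_mset_sum_list)
  moreover have "int n dvd sum_list (take j xs) - sum_list (take i xs)"
    using ij(3) unfolding f_def by (metis mod_eq_dvd_iff)
  ultimately have "zero_sum n T" by (simp add: zero_sum_def)
  moreover have "size T = j - i" using ij len by (simp add: T_def)
  moreover have "T \<subseteq># M"
    unfolding T_def xs[symmetric]
    by (metis append_take_drop_id mset_append mset_subset_eq_add_left mset_subset_eq_add_right
        subset_mset.order_trans)
  ultimately show ?thesis using that ij by (metis diff_le_self le_trans less_numeral_extra(3) size_empty zero_less_diff)
qed

lemma exists_minimal_zero_sum:
  assumes "zero_sum n M" "M \<noteq> {#}"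
  obtains T where "T \<subseteq># M" "minimal_zero_sum n T"
proof -
  have "\<exists>T. T \<subseteq># M \<and> minimal_zero_sum n T"
    using assms
  proof (induction "size M" arbitrary: M rule: less_induct)
    case less
    show ?case
    proof (cases "minimal_zero_sum n M")
      case False
      then obtain T where T: "T \<subseteq># M" "zero_sum n T" "T \<noteq> {#}" "T \<noteq> M"
        using less.prems by (auto simp: minimal_zero_sum_def)
      hence "size T < size M" by (simp add: mset_subset_size subset_mset.less_le)
      then show ?thesis using less.hyps[of T] T by (meson subset_mset.order_trans)
    qed auto
  qed
  thus ?thesis using that by blast
qed

lemma factorization_exists:
  assumes "zero_sum n M"
  obtains Ts where "M = \<Sum>\<^sub># Ts" "\<forall>T\<in>#Ts. minimal_zero_sum n T"
proof -
  have "\<exists>Ts. M = \<Sum>\<^sub># Ts \<and> (\<forall>T\<in>#Ts. minimal_zero_sum n T)"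
    using assms
  proof (induction "size M" arbitrary: M rule: less_induct)
    case less
    show ?case
    proof (cases "M = {#}")
      case True
      thus ?thesis by (intro exI[of _ "{#}"]) auto
    next
      case False
      then obtain T where T: "T \<subseteq># M" "minimal_zero_sum n T"
        using less.prems exists_minimal_zero_sum by blast
      hence "T \<noteq> {#}" "zero_sum n T" by (auto simp: minimal_zero_sum_def)
      hence "size (M - T) < size M" "zero_sum n (M - T)"
        using T less.prems zero_sum_diff
        by (auto simp: size_Diff_submset nonempty_has_size dest: size_mset_mono)
      then obtain Ts where "M - T = \<Sum>\<^sub># Ts" "\<forall>T\<in>#Ts. minimal_zero_sum n T"
        using less.hyps by blast
      thus ?thesis using T by (intro exI[of _ "add_mset T Ts"]) (auto simp flip: \<open>M - T = _\<close>)
    qed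
  qed
  thus ?thesis using that by blast
qed

lemma minimal_zero_sum_size_ge2:
  assumes "minimal_zero_sum n T" "\<forall>x\<in>#T. 0 < x \<and> x < int n"
  shows "size T \<ge> 2"
proof (rule ccontr)
  assume "\<not> ?thesis"
  hence "size T = 1" using assms(1) nonempty_has_size[of T]
    by (auto simp: minimal_zero_sum_def)
  then obtain x where "T = {#x#}" using size_1_singleton_mset by blast
  thus False using assms by (auto simp: minimal_zero_sum_def zero_sum_def zdvd_not_zless)
qed

section \<open>A long minimal zero-sum multiset in a long multiset\<close>

lemma size_le_Max_count:
  assumes "\<forall>x\<in>#S. count S x \<le> M" "set_mset S \<subseteq> X" "finite X"
  shows "size S \<le> M * card X"
proof -
  have "size S = (\<Sum>x\<in>set_mset S. count S x)" by (simp add: size_multiset_overloaded_eq)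
  also have "\<dots> \<le> (\<Sum>x\<in>set_mset S. M)" using assms(1) by (intro sum_mono) auto
  also have "\<dots> \<le> M * card X" using card_mono[OF assms(3,2)] by simp
  finally show ?thesis .
qed

lemma replicate_minimal_zero_sum:
  assumes "g \<in> residues_of_order n d" "n > 0" "d > 0"
  shows "minimal_zero_sum n (replicate_mset d g)"
  unfolding minimal_zero_sum_def
proof (intro conjI allI impI)
  show "replicate_mset d g \<noteq> {#}" using assms(3) by (simp add: nonempty_has_size)
  show "zero_sum n (replicate_mset d g)"
    using residues_of_order_dvd_iff[OF assms(1,2), of "int d"] by (simp add: zero_sum_def)
next
  fix T assume "T \<subseteq># replicate_mset d g" "zero_sum n T"
  then obtain k where k: "T = replicate_mset k g" "k \<le> d"
    using msubseteq_replicate_msetE by (metis size_mset_mono size_replicate_mset)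
  hence "d dvd k" using residues_of_order_dvd_iff[OF assms(1,2), of "int k"] \<open>zero_sum n T\<close>
    by (simp add: zero_sum_def)
  hence "k = 0 \<or> k = d" using k(2) by (auto dest: dvd_imp_le)
  thus "T = {#} \<or> T = replicate_mset d g" using k(1) by auto
qed

text \<open>The set \<open>E\<close> consists of the residues that \<open>A + {0, g, \<dots>, Mg}\<close> reaches using fewer than \<open>L\<close> steps \<open>g\<close>, but
  never using \<open>L\<close> or more. Map \<open>(e, t)\<close> with \<open>e \<in> E\<close> and \<open>t \<le> M - L\<close> to \<open>e + tg\<close>. If two pairs with parameters
  \<open>t + L \<le> t'\<close> had the same image, then \<open>e = e' + (t' - t)g\<close> would be reached with at least \<open>L\<close> steps;
  so each fibre has at most \<open>L\<close> elements. The value \<open>-g\<close> is not attained, which leaves \<open>d - 1\<close> fibres.\<close>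

lemma card_escaping_sums:
  fixes A :: "int set" and L M n d :: nat
  assumes "n > 0" "d dvd n" "A \<subseteq> torsion n d" "g \<in> residues_of_order n d" "L \<le> M"
    and avoid: "\<And>a i. a \<in> A \<Longrightarrow> 1 \<le> i \<Longrightarrow> i \<le> M \<Longrightarrow> \<not> int n dvd a + int i * g"
  defines "E \<equiv> {e \<in> torsion n d. (\<exists>a\<in>A. \<exists>i<L. int n dvd a + int i * g - e) \<and>
                  \<not> (\<exists>a\<in>A. \<exists>i. L \<le> i \<and> i \<le> M \<and> int n dvd a + int i * g - e)}"
  shows "card E * (M - L + 1) \<le> L * (d - 1)"
proof (cases "L = 0")
  case True
  hence "E = {}" by (auto simp: E_def)
  thus ?thesis by simp
next
  case False
  have gt: "int n dvd int d * g" using residues_of_order_dvd_iff[OF assms(4,1), of "int d"] by simp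
  define Y where "Y = torsion n d - {(- g) mod int n}"
  define f where "f = (\<lambda>(e, t). (e + int t * g) mod int n)"
  have fE: "finite E" unfolding E_def by (rule finite_subset[OF _ finite_torsion]) auto
  have neg: "(- g) mod int n \<in> torsion n d" using gt by (intro mod_in_torsion assms(1)) simp
  have cY: "card Y = d - 1"
    unfolding Y_def using neg card_torsion[OF assms(2,1)] by (simp add: card_Diff_singleton)
  have fY: "f ` (E \<times> {..M - L}) \<subseteq> Y"
  proof safe
    fix e t assume e: "e \<in> E" and t: "t \<le> M - L"
    have "int n dvd int d * e" using e by (auto simp: E_def torsion_def)
    hence "int n dvd int d * e + int t * (int d * g)"
      by (rule dvd_add[OF _ dvd_mult[OF gt]])
    hence "(e + int t * g) mod int n \<in> torsion n d"
      by (intro mod_in_torsion assms(1)) (simp add: algebra_simps)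
    moreover have "(e + int t * g) mod int n \<noteq> (- g) mod int n"
    proof
      assume "(e + int t * g) mod int n = (- g) mod int n"
      hence 1: "int n dvd e + int t * g - (- g)" by (simp add: mod_eq_dvd_iff)
      obtain a i where ai: "a \<in> A" "i < L" "int n dvd a + int i * g - e"
        using e by (auto simp: E_def)
      from dvd_add[OF 1 ai(3)] have "int n dvd a + int (i + t + 1) * g"
        by (simp add: algebra_simps)
      thus False using avoid[OF ai(1), of "i + t + 1"] ai(2) t assms(5) by linarith
    qed
    ultimately show "f (e, t) \<in> Y" by (simp add: f_def Y_def)
  qed
  have phi_fibre: "card {z \<in> E \<times> {..M - L}. f z = y} \<le> L" for y
  proof -
    define F where "F = {z \<in> E \<times> {..M - L}. f z = y}"
    have finF: "finite F" unfolding F_def using fE by simp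
    have close: "t' < t + L" if "(e, t) \<in> F" "(e', t') \<in> F" for e t e' t'
    proof (rule ccontr)
      assume c: "\<not> t' < t + L"
      have e: "e \<in> E" "e' \<in> E" "t' \<le> M - L" using that by (auto simp: F_def)
      obtain a i where ai: "a \<in> A" "i < L" "int n dvd a + int i * g - e'"
        using e by (auto simp: E_def)
      have "f (e', t') = f (e, t)" using that by (simp add: F_def)
      hence 1: "int n dvd e' + int t' * g - (e + int t * g)" by (simp add: f_def mod_eq_dvd_iff)
      have "int n dvd a + int (i + (t' - t)) * g - e"
        using dvd_add[OF ai(3) 1] c by (simp add: algebra_simps of_nat_diff)
      moreover have "L \<le> i + (t' - t)" "i + (t' - t) \<le> M" using c ai(2) e(3) assms(5) by linarith+
      ultimately show False using e(1) ai(1) unfolding E_def by blast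
    qed
    have inj: "inj_on snd F"
    proof (rule inj_onI)
      fix z z' assume z: "z \<in> F" "z' \<in> F" "snd z = snd z'"
      obtain e t e' where zz: "z = (e, t)" "z' = (e', t)" using z(3) by (metis prod.collapse)
      have "(e + int t * g) mod int n = (e' + int t * g) mod int n"
        using z zz by (simp add: F_def f_def)
      hence "int n dvd e - e'" by (simp add: mod_eq_dvd_iff)
      hence "e mod int n = e' mod int n" by (simp only: mod_eq_dvd_iff)
      thus "z = z'" using z zz by (auto simp: F_def E_def torsion_def)
    qed
    show ?thesis
    proof (cases "F = {}")
      case True
      thus ?thesis unfolding F_def[symmetric] by simp
    next
      case ne: False
      define t0 where "t0 = Min (snd ` F)"
      have "t0 \<in> snd ` F" unfolding t0_def using ne finF by (intro Min_in) auto
      then obtain e0 where e0: "(e0, t0) \<in> F" by auto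
      have "t0 \<le> t" if "t \<in> snd ` F" for t using that finF by (simp add: t0_def)
      hence "snd ` F \<subseteq> {t0..<t0 + L}" using close[OF e0] by force
      hence "card (snd ` F) \<le> L" using card_mono[of "{t0..<t0+L}"] by simp
      thus ?thesis using card_image[OF inj] unfolding F_def[symmetric] by simp
    qed
  qed
  have "card E * (M - L + 1) = card (E \<times> {..M - L})" by (simp add: card_cartesian_product)
  also have "E \<times> {..M - L} = (\<Union>y\<in>Y. {z \<in> E \<times> {..M - L}. f z = y})" using fY by blast
  also have "card \<dots> \<le> (\<Sum>y\<in>Y. card {z \<in> E \<times> {..M - L}. f z = y})"
    by (rule card_UN_le) (auto simp: Y_def finite_torsion)
  also have "\<dots> \<le> (\<Sum>y\<in>Y. L)" by (intro sum_mono phi_fibre)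
  finally show ?thesis using cY by (simp add: mult.commute)
qed

text \<open>The multiplicities may be assumed to be below \<open>d\<close>, since \<open>d\<close> copies of one element of order \<open>d\<close> form a
  minimal zero-sum multiset of length \<open>d\<close>. The length \<open>h/2\<close> comes from the last inequality of the proof:
  with \<open>L\<close> an upper bound for the lengths, it reads \<open>M L \<le> (h - 2)(M - L + 1)\<close> and holds for all \<open>M \<ge> h\<close>
  as soon as \<open>2L \<le> h - 1\<close>.\<close>

lemma long_minimal_zero_sum:
  assumes "n > 0" "d dvd n" "d \<ge> 2" "set_mset S \<subseteq> residues_of_order n d"
    and "h \<ge> 3" "(h - 1) * (d - 1) < size S" "\<forall>x. count S x < d"
  shows "\<exists>T. T \<subseteq># S \<and> minimal_zero_sum n T \<and> h \<le> 2 * size T"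
proof (rule ccontr)
  assume "\<not> ?thesis"
  hence short: "2 * size T < h" if "T \<subseteq># S" "minimal_zero_sum n T" for T
    using that not_le by blast
  define L where "L = (h - 1) div 2"
  have L: "L \<ge> 1" "2 * L \<le> h - 1" using assms(5) by (auto simp: L_def)
  have short': "size T \<le> L" if "T \<subseteq># S" "minimal_zero_sum n T" for T
    using short[OF that] by (simp add: L_def)
  define Q where "Q = residues_of_order n d"
  have tor: "Q \<subseteq> torsion n d" unfolding Q_def by (rule residues_of_order_torsion[OF assms(1)])
  have Q0: "0 \<notin> Q" unfolding Q_def using residues_of_order_nonzero[OF assms(3,1)] by blast
  have SQ: "set_mset S \<subseteq> Q" using assms(4) by (simp add: Q_def)
  have SX: "set_mset S \<subseteq> torsion n d - {0}" using SQ tor Q0 by blast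
  have "0 \<in> torsion n d" using assms(1) by (simp add: torsion_def)
  hence cX: "card (torsion n d - {0}) = d - 1" using card_torsion[OF assms(2,1)] by simp
  have "S \<noteq> {#}" using assms(6) by auto
  define M where "M = Max (count S ` set_mset S)"
  have "M \<in> count S ` set_mset S" unfolding M_def using \<open>S \<noteq> {#}\<close> by (intro Max_in) auto
  then obtain g where g: "g \<in># S" "count S g = M" by auto
  have M_max: "count S x \<le> M" if "x \<in># S" for x unfolding M_def using that by simp
  have "size S \<le> M * (d - 1)"
    using size_le_Max_count[OF _ SX] M_max cX finite_torsion by (metis finite_Diff)
  hence "(h - 1) * (d - 1) < M * (d - 1)" using assms(6) by linarith
  hence "h - 1 < M" by (simp only: mult_less_cancel2)
  hence M: "h \<le> M" by linarith
  have gQ: "g \<in> residues_of_order n d" using g(1) assms(4) by auto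
  \<comment> \<open>The part of \<open>S\<close> from which the maximal zero-sum free extension of \<open>g\<^sup>M\<close> is chosen.\<close>
  define R where "R = filter_mset (\<lambda>x. x \<noteq> g) S"
  have S_eq: "S = replicate_mset M g + R"
    unfolding R_def using g(2) by (auto intro!: multiset_eqI)
  define free where "free X \<longleftrightarrow> (\<forall>T. T \<subseteq># X \<longrightarrow> zero_sum n T \<longrightarrow> T = {#})" for X
  define ok where "ok R' \<longleftrightarrow> R' \<subseteq># R \<and> free (replicate_mset M g + R')" for R'
  have "free (replicate_mset M g)"
    unfolding free_def
  proof (intro allI impI)
    fix T assume T: "T \<subseteq># replicate_mset M g" "zero_sum n T"
    have Md: "M < d" using assms(7) g(2) by blast
    hence "replicate_mset M g \<subseteq># replicate_mset d g"
      by (simp add: replicate_mset_msubseteq_iff)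
    hence Td: "T \<subseteq># replicate_mset d g" using T(1) by (rule subset_mset.order_trans[rotated])
    hence "T = {#} \<or> T = replicate_mset d g"
      using replicate_minimal_zero_sum[OF gQ assms(1)] T(2) assms(3) by (simp add: minimal_zero_sum_def)
    moreover have "size T \<le> M" using size_mset_mono[OF T(1)] by simp
    ultimately show "T = {#}" using Md by auto
  qed
  hence "ok {#}" by (simp add: ok_def)
  moreover have "\<forall>y. ok y \<longrightarrow> size y < Suc (size R)"
    by (simp add: ok_def size_mset_mono less_Suc_eq_le)
  ultimately have "\<exists>x. ok x \<and> (\<forall>y. ok y \<longrightarrow> size y \<le> size x)"
    by (rule ex_has_greatest_nat)
  then obtain R' where R': "ok R'" "\<And>y. ok y \<Longrightarrow> size y \<le> size R'" by blast
  have R'R: "R' \<subseteq># R" and fr: "free (replicate_mset M g + R')" using R'(1) by (auto simp: ok_def)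
  define S' where "S' = replicate_mset M g + R'"
  have S'S: "S' \<subseteq># S" using R'R by (simp add: S'_def S_eq)
  have "size S' < d"
  proof (rule ccontr)
    assume "\<not> ?thesis"
    moreover have "set_mset S' \<subseteq> torsion n d" using S'S SQ tor by (meson order.trans set_mset_mono)
    ultimately obtain T where "T \<subseteq># S'" "T \<noteq> {#}" "zero_sum n T"
      using short_zero_sum[OF assms(2,1), of S'] by auto
    thus False using fr by (auto simp: free_def S'_def)
  qed
  define A where "A = {\<Sum>\<^sub># T mod int n | T. T \<subseteq># R'}"
  define E where "E = {e \<in> torsion n d. (\<exists>a\<in>A. \<exists>i<L. int n dvd a + int i * g - e) \<and>
                  \<not> (\<exists>a\<in>A. \<exists>i. L \<le> i \<and> i \<le> M \<and> int n dvd a + int i * g - e)}"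
  have AT: "A \<subseteq> torsion n d"
  proof
    fix a assume "a \<in> A"
    then obtain T where T: "T \<subseteq># R'" "a = \<Sum>\<^sub># T mod int n" by (auto simp: A_def)
    have "set_mset T \<subseteq> torsion n d"
      using T(1) R'R SQ tor S_eq by (auto dest!: mset_subset_eqD)
    thus "a \<in> torsion n d" using T(2) mod_in_torsion[OF assms(1)] sum_mset_torsion by blast
  qed
  have A_rep: "int n dvd a + c \<longleftrightarrow> int n dvd \<Sum>\<^sub># T + c" if "a = \<Sum>\<^sub># T mod int n" for a c T
    using that by (metis dvd_eq_mod_eq_0 mod_add_left_eq)
  have cE: "card E * (M - L + 1) \<le> L * (d - 1)"
    unfolding E_def
  proof (rule card_escaping_sums[OF assms(1,2) AT gQ])
    show "L \<le> M" using L M by linarith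
    fix a i assume ai: "a \<in> A" "1 \<le> i" "i \<le> M"
    then obtain T where T: "T \<subseteq># R'" "a = \<Sum>\<^sub># T mod int n" by (auto simp: A_def)
    show "\<not> int n dvd a + int i * g"
    proof
      assume "int n dvd a + int i * g"
      hence "zero_sum n (replicate_mset i g + T)"
        using A_rep[OF T(2)] by (simp add: zero_sum_def add.commute)
      moreover have "replicate_mset i g + T \<subseteq># replicate_mset M g + R'"
        using T(1) ai(3) by (intro subset_mset.add_mono) (auto simp: replicate_mset_msubseteq_iff)
      ultimately show False using fr ai(2) unfolding free_def by fastforce
    qed
  qed
  \<comment> \<open>An unused \<open>x\<close> closes a zero-sum multiset, and each one that it closes is minimal, hence short.\<close>
  have inE: "(- x) mod int n \<in> E" if x: "x \<in># R - R'" for x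
  proof -
    have "{#x#} \<subseteq># R - R'" using x by simp
    hence xR: "add_mset x R' \<subseteq># R"
      using subset_mset.le_diff_conv2[OF R'R, of "{#x#}"] by simp
    hence xS: "add_mset x S' \<subseteq># S" by (simp add: S'_def S_eq)
    have "x \<in># S" using x S_eq by (auto dest: in_diffD)
    hence xT: "x \<in> torsion n d" using SQ tor by blast
    \<comment> \<open>Of a zero-sum part and its complement, one avoids this copy of \<open>x\<close> and so lies in \<open>S'\<close>.\<close>
    have min: "minimal_zero_sum n (add_mset x T0)" if T0: "T0 \<subseteq># S'" "zero_sum n (add_mset x T0)" for T0
      unfolding minimal_zero_sum_def
    proof (intro conjI allI impI)
      fix T assume T: "T \<subseteq># add_mset x T0" "zero_sum n T"
      show "T = {#} \<or> T = add_mset x T0"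
      proof (cases "T \<subseteq># T0")
        case True
        thus ?thesis using T(2) T0(1) fr unfolding free_def S'_def by (meson subset_mset.order_trans)
      next
        case False
        define U where "U = add_mset x T0 - T"
        have U: "zero_sum n U" unfolding U_def by (rule zero_sum_diff[OF T0(2) T])
        have "\<exists>y. count T y > count T0 y" using False by (meson not_le subseteq_mset_def)
        then obtain y where "count T y > count T0 y" by blast
        moreover have "count T y \<le> count (add_mset x T0) y" using T(1) by (simp add: subseteq_mset_def)
        ultimately have "count T x > count T0 x" by (auto split: if_splits)
        hence "U \<subseteq># T0" unfolding U_def by (auto simp: subseteq_mset_def)
        hence "U = {#}" using U T0(1) fr unfolding free_def S'_def by (meson subset_mset.order_trans)
        thus ?thesis using T(1) unfolding U_def by (metis subset_mset.add_diff_inverse add.right_neutral)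
      qed
    qed (use T0 in auto)
    have "\<not> ok (add_mset x R')" using R'(2)[of "add_mset x R'"] by auto
    hence "\<not> free (add_mset x S')" using xR by (simp add: ok_def S'_def)
    then obtain T where T: "T \<subseteq># add_mset x S'" "zero_sum n T" "T \<noteq> {#}"
      by (auto simp: free_def)
    have "x \<in># T"
    proof (rule ccontr)
      assume "x \<notin># T"
      hence "T \<subseteq># S'" using T(1)
        by (intro mset_subset_eqI) (metis count_add_mset le0 mset_subset_eq_count not_in_iff)
      thus False using T fr by (auto simp: free_def S'_def)
    qed
    then obtain T0 where T0: "T = add_mset x T0" by (metis multi_member_split)
    have T0S: "T0 \<subseteq># S'" using T(1) T0 by simp
    have split: "\<exists>i T1. T0 = replicate_mset i g + T1 \<and> i \<le> M \<and> T1 \<subseteq># R'"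
    proof (intro exI conjI)
      show "T0 = replicate_mset (count T0 g) g + filter_mset (\<lambda>y. y \<noteq> g) T0"
        by (auto intro!: multiset_eqI)
      have gR: "g \<notin># R'" using R'R by (auto simp: R_def dest: mset_subset_eqD)
      show "count T0 g \<le> M"
        using mset_subset_eq_count[OF T0S, of g] not_in_iff[THEN iffD1, OF gR] by (simp add: S'_def)
      have "filter_mset (\<lambda>y. y \<noteq> g) T0 \<subseteq># filter_mset (\<lambda>y. y \<noteq> g) S'"
        using T0S by (rule multiset_filter_mono)
      also have "filter_mset (\<lambda>y. y \<noteq> g) S' = R'"
      proof -
        have "filter_mset (\<lambda>y. y \<noteq> g) R' = R'" using gR by (auto simp: filter_mset_eq_conv)
        thus ?thesis by (simp add: S'_def)
      qed
      finally show "filter_mset (\<lambda>y. y \<noteq> g) T0 \<subseteq># R'" .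
    qed
    then obtain i T1 where T1: "T0 = replicate_mset i g + T1" "i \<le> M" "T1 \<subseteq># R'" by blast
    have few: "j < L" if "T2 \<subseteq># R'" "j \<le> M" "int n dvd \<Sum>\<^sub># T2 + int j * g + x" for T2 j
    proof -
      have s: "replicate_mset j g + T2 \<subseteq># S'"
        unfolding S'_def using that by (intro subset_mset.add_mono) (auto simp: replicate_mset_msubseteq_iff)
      have "zero_sum n (add_mset x (replicate_mset j g + T2))"
        using that(3) by (simp add: zero_sum_def algebra_simps)
      from min[OF s this] short'[of "add_mset x (replicate_mset j g + T2)"] s xS
      have "size (add_mset x (replicate_mset j g + T2)) \<le> L"
        by (meson add_mset_add_mset_same_iff mset_subset_eq_add_mset_cancel subset_mset.order_trans)
      thus ?thesis by simp
    qed
    have rel: "int n dvd a + int j * g - (- x) mod int n \<longleftrightarrow> int n dvd \<Sum>\<^sub># T2 + int j * g + x"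
      if "a = \<Sum>\<^sub># T2 mod int n" for a j T2
    proof -
      have "int n dvd a + int j * g - (- x) mod int n \<longleftrightarrow> int n dvd \<Sum>\<^sub># T2 + (int j * g - (- x) mod int n)"
        using A_rep[OF that, of "int j * g - (- x) mod int n"] by (simp only: add_diff_eq)
      also have "\<dots> \<longleftrightarrow> (\<Sum>\<^sub># T2 + int j * g) mod int n = ((- x) mod int n) mod int n"
        by (simp only: mod_eq_dvd_iff add_diff_eq)
      also have "\<dots> \<longleftrightarrow> int n dvd \<Sum>\<^sub># T2 + int j * g + x"
        by (simp only: mod_mod_trivial mod_eq_dvd_iff) simp
      finally show ?thesis .
    qed
    have tot: "int n dvd \<Sum>\<^sub># T1 + int i * g + x"
      using T(2) by (simp add: T0 T1(1) zero_sum_def algebra_simps)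
    show ?thesis
      unfolding E_def
    proof (intro CollectI conjI)
      show "(- x) mod int n \<in> torsion n d"
        using xT by (intro mod_in_torsion assms(1)) (simp add: torsion_def)
      show "\<exists>a\<in>A. \<exists>i<L. int n dvd a + int i * g - (- x) mod int n"
        using few[OF T1(3,2) tot] tot rel[OF refl] T1(3) unfolding A_def by blast
      show "\<not> (\<exists>a\<in>A. \<exists>i\<ge>L. i \<le> M \<and> int n dvd a + int i * g - (- x) mod int n)"
      proof safe
        fix a j assume a: "a \<in> A" "L \<le> j" "j \<le> M" "int n dvd a + int j * g - (- x) mod int n"
        then obtain T2 where "T2 \<subseteq># R'" "a = \<Sum>\<^sub># T2 mod int n" by (auto simp: A_def)
        thus False using few[of T2 j] a rel by auto
      qed
    qed
  qed
  have fE: "finite E" unfolding E_def by (rule finite_subset[OF _ finite_torsion]) auto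
  have inj: "inj_on (\<lambda>x. (- x) mod int n) (set_mset (R - R'))"
  proof (rule inj_onI)
    fix x y assume xy: "x \<in># R - R'" "y \<in># R - R'" "(- x) mod int n = (- y) mod int n"
    have "x \<in> torsion n d" "y \<in> torsion n d"
      using xy(1,2) SX S_eq by (auto dest!: in_diffD)
    moreover have "int n dvd - x - - y" using xy(3) by (simp only: mod_eq_dvd_iff)
    hence "x mod int n = y mod int n" by (metis minus_diff_commute mod_eq_dvd_iff add.commute diff_minus_eq_add uminus_add_conv_diff)
    ultimately show "x = y" by (simp add: torsion_def)
  qed
  have "card (set_mset (R - R')) = card ((\<lambda>x. (- x) mod int n) ` set_mset (R - R'))"
    using card_image[OF inj] by simp
  also have "\<dots> \<le> card E" using inE fE by (intro card_mono) auto
  finally have cR: "card (set_mset (R - R')) \<le> card E" .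
  have "size (R - R') \<le> M * card (set_mset (R - R'))"
  proof (rule size_le_Max_count)
    show "\<forall>x\<in>#R - R'. count (R - R') x \<le> M"
    proof
      fix x assume "x \<in># R - R'"
      hence "x \<in># S" using S_eq by (auto dest: in_diffD)
      have "count (R - R') x \<le> count S x" by (simp add: S_eq)
      thus "count (R - R') x \<le> M" using M_max[OF \<open>x \<in># S\<close>] by linarith
    qed
  qed auto
  also have "\<dots> \<le> M * card E" using cR by simp
  finally have "size (R - R') \<le> M * card E" .
  moreover have "size S = size S' + size (R - R')"
    using R'R by (simp add: S_eq S'_def size_Diff_submset size_mset_mono)
  ultimately have "size S \<le> (d - 1) + M * card E" using \<open>size S' < d\<close> by linarith
  hence "size S * (M - L + 1) \<le> (d - 1) * (M - L + 1) + M * (card E * (M - L + 1))"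
    by (metis add_mult_distrib mult.assoc mult_le_mono1)
  also have "\<dots> \<le> (d - 1) * (M - L + 1) + M * (L * (d - 1))" using cE by simp
  also have "\<dots> = (d - 1) * ((M - L + 1) + M * L)" by (simp add: algebra_simps)
  also have "\<dots> \<le> (d - 1) * ((M - L + 1) * (h - 1))"
  proof (intro mult_le_mono2)
    have "2 * L + 1 \<le> h" using L assms(5) by linarith
    then obtain k where k: "h = 2 * L + 1 + k" using le_Suc_ex by blast
    \<comment> \<open>Substituting the slack variables turns the difference of both sides into a sum of nonnegative terms.\<close>
    obtain l where l: "M = h + l" using M le_Suc_ex by blast
    obtain m where m: "L = m + 1" using L(1) by (metis add.commute le_Suc_ex)
    show "M - L + 1 + M * L \<le> (M - L + 1) * (h - 1)"
      unfolding l k m by (simp add: algebra_simps)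
  qed
  finally have "size S * (M - L + 1) \<le> ((h - 1) * (d - 1)) * (M - L + 1)"
    by (simp only: ac_simps)
  hence "size S \<le> (h - 1) * (d - 1)" by (simp only: mult_le_cancel2)
  thus False using assms(6) by linarith
qed

section \<open>Factorizations of zero-sum multisets with few factors\<close>

text \<open>Apply the preceding lemma with \<open>h\<close> the least integer such that \<open>size S \<le> h (d - 1)\<close>. If
  \<open>h \<le> 2\<close>, any minimal zero-sum part is long enough.\<close>

lemma minimal_zero_sum_among_many:
  assumes "n > 0" "d dvd n" "d \<ge> 2" "set_mset S \<subseteq> residues_of_order n d" "size S > d - 1"
  shows "\<exists>T. T \<subseteq># S \<and> minimal_zero_sum n T \<and>
           (size T = d \<or> (size S \<le> (d - 1)\<^sup>2 \<and> size S \<le> 2 * (d - 1) * size T))"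
proof (cases "\<exists>x. count S x \<ge> d")
  case True
  then obtain x where x: "count S x \<ge> d" by blast
  hence "x \<in># S" using assms(3) by (metis count_greater_zero_iff less_le_trans zero_less_numeral)
  hence "minimal_zero_sum n (replicate_mset d x)"
    using assms by (intro replicate_minimal_zero_sum) auto
  thus ?thesis using x by (intro exI[of _ "replicate_mset d x"]) (simp add: count_le_replicate_mset_subset_eq)
next
  case False
  hence few: "\<forall>x. count S x < d" by (meson not_le)
  have d0: "d > 0" using assms(3) by simp
  have tor: "set_mset S \<subseteq> torsion n d" using assms(4) residues_of_order_torsion[OF assms(1)] by blast
  have "0 \<in> torsion n d" using assms(1) by (simp add: torsion_def)
  hence cX: "card (torsion n d - {0}) = d - 1" using card_torsion[OF assms(2,1)] by simp
  have "set_mset S \<subseteq> torsion n d - {0}"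
    using tor residues_of_order_nonzero[OF assms(3,1)] assms(4) by blast
  moreover have "\<forall>x\<in>#S. count S x \<le> d - 1"
  proof
    fix x show "count S x \<le> d - 1" using few[rule_format, of x] by linarith
  qed
  ultimately have sq: "size S \<le> (d - 1)\<^sup>2"
    using size_le_Max_count[of S "d - 1" "torsion n d - {0}"] cX finite_torsion
    by (simp add: power2_eq_square)
  define h where "h = (size S - 1) div (d - 1) + 1"
  have c: "0 < d - 1" using assms(3) by linarith
  have h1: "(h - 1) * (d - 1) < size S"
  proof -
    have "(h - 1) * (d - 1) \<le> size S - 1" by (simp add: h_def)
    thus ?thesis using assms(5) by linarith
  qed
  have h2: "size S \<le> h * (d - 1)"
  proof -
    have "h * (d - 1) = (size S - 1) div (d - 1) * (d - 1) + (d - 1)"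
      unfolding h_def by (simp only: distrib_right mult_1)
    thus ?thesis using dividend_less_div_times[OF c, of "size S - 1"] by linarith
  qed
  have "\<exists>T. T \<subseteq># S \<and> minimal_zero_sum n T \<and> h \<le> 2 * size T"
  proof (cases "h \<ge> 3")
    case True
    show ?thesis by (rule long_minimal_zero_sum[OF assms(1-4) True h1 few])
  next
    case h: False
    have "size S \<ge> d" using assms(5) by linarith
    then obtain T where T: "T \<subseteq># S" "T \<noteq> {#}" "zero_sum n T"
      using short_zero_sum[OF assms(2,1) tor] by blast
    then obtain U where U: "U \<subseteq># T" "minimal_zero_sum n U" using exists_minimal_zero_sum by blast
    hence "size U \<ge> 1" by (auto simp: minimal_zero_sum_def Suc_le_eq nonempty_has_size)
    moreover have "U \<subseteq># S" using U(1) T(1) by (rule subset_mset.order_trans)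
    ultimately show ?thesis using U(2) h by (intro exI[of _ U]) linarith
  qed
  then obtain T where T: "T \<subseteq># S" "minimal_zero_sum n T" "h \<le> 2 * size T" by blast
  have "size S \<le> (2 * size T) * (d - 1)"
    using h2 mult_le_mono1[OF T(3), of "d - 1"] by linarith
  thus ?thesis using T(1,2) sq by (intro exI[of _ T]) (simp add: ac_simps)
qed

text \<open>A decreasing price for the \<open>i\<close>-th remaining element, such that any atom extracted when \<open>s\<close> elements
  remain pays at least \<open>1\<close> even if all its elements have the price of the last one. The first summand
  serves atoms of length \<open>d\<close>, the second one atoms of length at least \<open>max 2 (s / (2(d - 1)))\<close>.\<close>

definition atom_weight :: "nat \<Rightarrow> nat \<Rightarrow> real" where
  "atom_weight d i =
     1 / real d + (if i \<le> (d - 1)\<^sup>2 then min (1 / 2) (2 * real (d - 1) / real i) else 0)"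

lemma atom_weight_antimono:
  assumes "1 \<le> i" "i \<le> j"
  shows "atom_weight d j \<le> atom_weight d i"
proof -
  have "2 * real (d - 1) / real j \<le> 2 * real (d - 1) / real i"
    using assms by (intro divide_left_mono) auto
  thus ?thesis using assms by (auto simp: atom_weight_def)
qed

lemma atom_weight_sum_step:
  assumes "1 / real l \<le> atom_weight d s" "0 < l" "l \<le> s"
  shows "(\<Sum>i=1..s - l. atom_weight d i) + 1 \<le> (\<Sum>i=1..s. atom_weight d i)"
proof -
  have "{1..s} = {1..s - l} \<union> {s - l + 1..s}" using assms by auto
  hence "(\<Sum>i=1..s. atom_weight d i) = (\<Sum>i=1..s - l. atom_weight d i) + (\<Sum>i=s - l + 1..s. atom_weight d i)"
    by (simp add: sum.union_disjoint)
  moreover have "(\<Sum>i=s - l + 1..s. 1 / real l) \<le> (\<Sum>i=s - l + 1..s. atom_weight d i)"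
    by (intro sum_mono order_trans[OF assms(1)] atom_weight_antimono) auto
  moreover have "(\<Sum>i=s - l + 1..s. 1 / real l) = 1" using assms by (simp add: of_nat_diff)
  ultimately show ?thesis by linarith
qed

text \<open>With \<open>c = d - 1\<close>, the first \<open>2c\<close> elements contribute \<open>1/2\<close> each, and the elements from \<open>2c\<close> to \<open>c\<^sup>2\<close>
  contribute at most \<open>2c (ln (c\<^sup>2) - ln (2c)) = 2c ln (c/2)\<close> by comparing the harmonic sum with the logarithm.\<close>

lemma atom_weight_sum_le:
  assumes "d \<ge> 2"
  shows "(\<Sum>i=1..s. atom_weight d i) \<le> real s / real d + real (d - 1) * (1 + 2 * ln (real d / 2))"
proof -
  define c where "c = d - 1"
  define v where "v i = (if i \<le> c\<^sup>2 then min (1 / 2) (2 * real c / real i) else 0)" for i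
  have c: "c \<ge> 1" using assms by (simp add: c_def)
  have v0: "v i \<ge> 0" for i by (auto simp: v_def)
  have small: "(\<Sum>i=1..2 * c. v i) \<le> real c"
  proof -
    have "(\<Sum>i=1..2 * c. v i) \<le> (\<Sum>i=1..2 * c. 1 / 2)" by (intro sum_mono) (auto simp: v_def)
    thus ?thesis by simp
  qed
  have large: "(\<Sum>i=1..2 * c+k. v i) \<le> real c + 2 * real c * ln (real (2 * c+k) / real (2 * c))"
    for k
  proof (induction k)
    case 0
    thus ?case using small c by simp
  next
    case (Suc k)
    define m where "m = real (2 * c+k)"
    have m: "m > 0" using c by (simp add: m_def)
    have "v (2 * c + Suc k) \<le> 2 * real c / (m + 1)"
      using c by (auto simp: v_def m_def algebra_simps)
    also have "1 / (m + 1) \<le> ln ((m + 1) / m)"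
    proof -
      have "ln (m / (m + 1)) \<le> m / (m + 1) - 1" using m by (intro ln_le_minus_one) auto
      also have "\<dots> = - (1 / (m + 1))" using m by (simp add: field_simps)
      finally show ?thesis using m by (simp add: ln_div)
    qed
    hence "2 * real c / (m + 1) \<le> 2 * real c * ln ((m + 1) / m)"
      using mult_left_mono[of "1 / (m+1)" "ln ((m+1)/m)" "2 * real c"] by simp
    finally have "v (2 * c + Suc k) \<le> 2 * real c * ln ((m + 1) / m)" .
    moreover have "ln ((m + 1) / real (2 * c)) = ln (m / real (2 * c)) + ln ((m + 1) / m)"
      using m c by (simp add: ln_div)
    ultimately show ?case using Suc.IH by (simp add: m_def algebra_simps)
  qed
  have v_sum: "(\<Sum>i=1..s. v i) \<le> real c * (1 + 2 * ln (real d / 2))"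
  proof (cases "c = 1")
    case True
    have "(\<Sum>i=1..s. v i) \<le> (\<Sum>i=1..s. if i = 1 then 1/2 else 0)"
      by (intro sum_mono) (auto simp: v_def True)
    also have "\<dots> \<le> 1" by simp
    finally have "(\<Sum>i=1..s. v i) \<le> 1" .
    moreover have "d = 2" using True assms by (simp add: c_def)
    ultimately show ?thesis using True by simp
  next
    case False
    hence c2: "c \<ge> 2" using c by simp
    hence cc: "2 * c \<le> c\<^sup>2" by (simp add: power2_eq_square)
    have "(\<Sum>i=1..s. v i) \<le> (\<Sum>i=1..c\<^sup>2. v i)"
    proof -
      have "(\<Sum>i=1..s. v i) = (\<Sum>i\<in>{1..s} \<inter> {1..c\<^sup>2}. v i)"
        by (intro sum.mono_neutral_right) (auto simp: v_def)
      also have "\<dots> \<le> (\<Sum>i=1..c\<^sup>2. v i)" by (intro sum_mono2) (auto simp: v0)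
      finally show ?thesis .
    qed
    also have "\<dots> \<le> real c + 2 * real c * ln (real (c\<^sup>2) / real (2 * c))"
      using large[of "c\<^sup>2 - 2 * c"] cc by simp
    also have "real (c\<^sup>2) / real (2 * c) = real c / 2" using c by (simp add: power2_eq_square)
    also have "ln (real c / 2) \<le> ln (real d / 2)" using c2 by (simp add: c_def)
    finally show ?thesis using c by (simp add: algebra_simps)
  qed
  have "(\<Sum>i=1..s. atom_weight d i) = real s / real d + (\<Sum>i=1..s. v i)"
    unfolding atom_weight_def v_def c_def[symmetric] sum.distrib by simp
  thus ?thesis using v_sum by (simp add: c_def)
qed

lemma minimal_zero_sum_of_order_size_ge2:
  assumes "minimal_zero_sum n T" "set_mset T \<subseteq> residues_of_order n d" "d \<ge> 2" "n > 0"
  shows "size T \<ge> 2"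
proof (rule minimal_zero_sum_size_ge2[OF assms(1)])
  show "\<forall>x\<in>#T. 0 < x \<and> x < int n"
    using assms(2) residues_of_order_nonzero[OF assms(3,4)] by (force simp: residues_of_order_def)
qed

lemma inverse_le_ratio:
  fixes s t x :: real
  assumes "s \<le> x * t" "0 < s" "0 < t"
  shows "1 / t \<le> x / s"
  using assms by (simp add: field_simps)

text \<open>The remainder \<open>R\<close> need not have sum zero and has to be merged with the remainders for the
  other orders; counting \<open>1/2\<close> for each of its elements pays for that later factorization.\<close>

lemma greedy_extraction:
  assumes "n > 0" "d dvd n" "d \<ge> 2" "set_mset S \<subseteq> residues_of_order n d"
  shows "\<exists>Ts R. S = \<Sum>\<^sub># Ts + R \<and> (\<forall>T\<in>#Ts. minimal_zero_sum n T) \<and>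
           real (size Ts) + real (size R) / 2 \<le> (\<Sum>i=1..size S. atom_weight d i)"
  using assms(4)
proof (induction "size S" arbitrary: S rule: less_induct)
  case less
  show ?case
  proof (cases "size S > d - 1")
    case False
    have "(\<Sum>i=1..size S. 1 / 2) \<le> (\<Sum>i=1..size S. atom_weight d i)"
    proof (intro sum_mono)
      fix i assume i: "i \<in> {1..size S}"
      hence i1: "i \<le> d - 1" using False by simp
      hence "real i \<le> real (d - 1)" by simp
      hence "1 / 2 \<le> 2 * real (d - 1) / real i" using i by (auto simp: pos_le_divide_eq)
      hence m: "min (1 / 2) (2 * real (d - 1) / real i) = 1 / 2" by (rule min_absorb1)
      have "i \<le> (d - 1)\<^sup>2" using i1 le_square[of "d - 1"] unfolding power2_eq_square by (rule le_trans)
      thus "1 / 2 \<le> atom_weight d i" unfolding atom_weight_def by (simp only: if_True m) simp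
    qed
    thus ?thesis by (intro exI[of _ "{#}"] exI[of _ S]) simp
  next
    case True
    obtain T where T: "T \<subseteq># S" "minimal_zero_sum n T"
        "size T = d \<or> (size S \<le> (d - 1)\<^sup>2 \<and> size S \<le> 2 * (d - 1) * size T)"
      using minimal_zero_sum_among_many[OF assms(1-3) less.prems True] by blast
    have T2: "size T \<ge> 2"
      using T(1) less.prems by (intro minimal_zero_sum_of_order_size_ge2[OF T(2) _ assms(3,1)]) (meson order.trans set_mset_mono)
    have w: "1 / real (size T) \<le> atom_weight d (size S)"
    proof (cases "size T = d")
      case True
      thus ?thesis by (simp add: atom_weight_def)
    next
      case False
      hence s: "size S \<le> (d - 1)\<^sup>2" "size S \<le> 2 * (d - 1) * size T" using T(3) by auto
      have r: "real (size S) \<le> (2 * real (d - 1)) * real (size T)"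
        using s(2) by (metis of_nat_le_iff of_nat_mult of_nat_numeral)
      have "1 / real (size T) \<le> 2 * real (d - 1) / real (size S)"
        by (rule inverse_le_ratio[OF r]) (use T2 True in simp_all)
      moreover have "1 / real (size T) \<le> 1 / 2" using T2 by (simp add: field_simps)
      ultimately have "1 / real (size T) \<le> min (1/2) (2 * real (d - 1) / real (size S))" by simp
      moreover have "0 \<le> 1 / real d" by simp
      ultimately show ?thesis unfolding atom_weight_def using s(1) by (simp only: if_True)
    qed
    have sz: "size (S - T) = size S - size T" "size T \<le> size S"
      using T(1) by (auto simp: size_Diff_submset size_mset_mono)
    have "set_mset (S - T) \<subseteq> residues_of_order n d" using less.prems by (auto dest: in_diffD)
    then obtain Ts R where TR: "S - T = \<Sum>\<^sub># Ts + R" "\<forall>T\<in>#Ts. minimal_zero_sum n T"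
        "real (size Ts) + real (size R) / 2 \<le> (\<Sum>i=1..size S - size T. atom_weight d i)"
      using less.hyps[of "S - T"] sz T2 by auto
    have "S = \<Sum>\<^sub># (add_mset T Ts) + R"
      using T(1) TR(1) by (metis (no_types) sum_mset.add_mset add.assoc subset_mset.add_diff_inverse)
    moreover have "real (size (add_mset T Ts)) + real (size R) / 2 \<le> (\<Sum>i=1..size S. atom_weight d i)"
      using atom_weight_sum_step[OF w _ sz(2)] T2 TR(3) by simp
    ultimately show ?thesis using TR(2) T(2) by (intro exI[of _ "add_mset T Ts"] exI[of _ R]) auto
  qed
qed

lemma size_sum_mset_ge:
  fixes Ts :: "'c multiset multiset"
  assumes "\<forall>T\<in>#Ts. k \<le> size T"
  shows "k * size Ts \<le> size (\<Sum>\<^sub># Ts)"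
  using assms by (induction Ts) (auto simp: algebra_simps)

text \<open>The trivial estimate \<open>s/2\<close> is kept because it is the smaller one when \<open>d\<close> is small.\<close>

definition order_bound :: "nat \<Rightarrow> nat \<Rightarrow> real" where
  "order_bound d s = min (real s / 2) (real s / real d + real (d - 1) * (1 + 2 * ln (real d / 2)))"

lemma extraction_bound:
  assumes "n > 0" "d dvd n" "d \<ge> 2" "set_mset S \<subseteq> residues_of_order n d"
  shows "\<exists>Ts R. S = \<Sum>\<^sub># Ts + R \<and> (\<forall>T\<in>#Ts. minimal_zero_sum n T) \<and>
           real (size Ts) + real (size R) / 2 \<le> order_bound d (size S)"
proof -
  obtain Ts R where TR: "S = \<Sum>\<^sub># Ts + R" "\<forall>T\<in>#Ts. minimal_zero_sum n T"
      "real (size Ts) + real (size R) / 2 \<le> (\<Sum>i=1..size S. atom_weight d i)"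
    using greedy_extraction[OF assms] by blast
  have "\<forall>T\<in>#Ts. 2 \<le> size T"
  proof
    fix T assume T: "T \<in># Ts"
    hence "set_mset T \<subseteq> set_mset S" using TR(1) by auto
    thus "2 \<le> size T" using TR(2) T assms by (intro minimal_zero_sum_of_order_size_ge2[of n T d]) auto
  qed
  hence "2 * size Ts \<le> size (\<Sum>\<^sub># Ts)" by (rule size_sum_mset_ge)
  hence "2 * size Ts + size R \<le> size S" by (simp add: TR(1))
  hence "2 * real (size Ts) + real (size R) \<le> real (size S)"
    by (metis of_nat_add of_nat_le_iff of_nat_mult of_nat_numeral)
  thus ?thesis using TR atom_weight_sum_le[OF assms(3), of "size S"]
    by (intro exI[of _ Ts] exI[of _ R]) (auto simp: order_bound_def)
qed

lemma residues_partition: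
  assumes "n > 0" "\<forall>x\<in>#B. 0 < x \<and> x < int n"
  shows "B = (\<Sum>d | d dvd n \<and> 1 < d. filter_mset (\<lambda>x. x \<in> residues_of_order n d) B)"
proof (rule multiset_eqI)
  fix x
  have fin: "finite {d. d dvd n \<and> 1 < d}" using assms(1) by simp
  show "count B x = count (\<Sum>d | d dvd n \<and> 1 < d. filter_mset (\<lambda>x. x \<in> residues_of_order n d) B) x"
  proof (cases "x \<in># B")
    case False
    thus ?thesis by (auto simp: count_sum not_in_iff intro!: sum.neutral)
  next
    case True
    hence x: "0 < x" "x < int n" using assms(2) by auto
    define g where "g = nat (gcd x (int n))"
    have g: "int g = gcd x (int n)" "g > 0" using x by (auto simp: g_def)
    have gn: "g dvd n" using g(1) by (metis gcd_dvd2 of_nat_dvd_iff)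
    define e where "e = n div g"
    have e: "g * e = n" using gn by (simp add: e_def)
    have "int g \<le> x" using g(1) x(1) by (simp add: zdvd_imp_le)
    hence "e \<noteq> 1" using x e by auto
    moreover have "e \<noteq> 0" using e assms(1) by (metis mult_0_right less_numeral_extra(3))
    ultimately have e1: "e dvd n" "1 < e" using e by (auto simp: mult.commute dvd_def)
    have iff: "x \<in> residues_of_order n d \<longleftrightarrow> d = e" for d
    proof -
      have "x \<in> residues_of_order n d \<longleftrightarrow> int g * int d = int n"
        using x g(1) by (simp add: residues_of_order_def)
      also have "\<dots> \<longleftrightarrow> g * d = g * e" using e by (metis of_nat_eq_iff of_nat_mult)
      finally show ?thesis using g(2) by simp
    qed
    have "count (\<Sum>d | d dvd n \<and> 1 < d. filter_mset (\<lambda>x. x \<in> residues_of_order n d) B) x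
        = (\<Sum>d | d dvd n \<and> 1 < d. if d = e then count B x else 0)"
      unfolding count_sum by (intro sum.cong) (auto simp: iff)
    thus ?thesis using e1 fin by (simp add: sum.delta)
  qed
qed

text \<open>The parts of fixed order are treated separately. Their remainders together form a zero-sum multiset
  without zeros, so all its minimal zero-sum parts have at least two elements.\<close>

lemma short_factorization:
  assumes "n > 0" "\<forall>x\<in>#B. 0 < x \<and> x < int n" "zero_sum n B"
  shows "\<exists>Ts. B = \<Sum>\<^sub># Ts \<and> (\<forall>T\<in>#Ts. minimal_zero_sum n T) \<and>
           real (size Ts) \<le> (\<Sum>d | d dvd n \<and> 1 < d.
              order_bound d (size (filter_mset (\<lambda>x. x \<in> residues_of_order n d) B)))"
proof -
  define D where "D = {d. d dvd n \<and> 1 < d}"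
  have fin: "finite D" using assms(1) by (simp add: D_def)
  define S where "S d = filter_mset (\<lambda>x. x \<in> residues_of_order n d) B" for d
  have B_eq: "B = (\<Sum>d\<in>D. S d)" unfolding D_def S_def by (rule residues_partition[OF assms(1,2)])
  have "\<forall>d\<in>D. \<exists>z. S d = \<Sum>\<^sub># (fst z) + snd z \<and> (\<forall>T\<in>#fst z. minimal_zero_sum n T) \<and>
           real (size (fst z)) + real (size (snd z)) / 2 \<le> order_bound d (size (S d))"
  proof
    fix d assume "d \<in> D"
    thus "\<exists>z. S d = \<Sum>\<^sub># (fst z) + snd z \<and> (\<forall>T\<in>#fst z. minimal_zero_sum n T) \<and>
           real (size (fst z)) + real (size (snd z)) / 2 \<le> order_bound d (size (S d))"
      using extraction_bound[OF assms(1), of d "S d"] by (auto simp: D_def S_def)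
  qed
  then obtain z where z: "\<forall>d\<in>D. S d = \<Sum>\<^sub># (fst (z d)) + snd (z d) \<and>
      (\<forall>T\<in>#fst (z d). minimal_zero_sum n T) \<and>
      real (size (fst (z d))) + real (size (snd (z d))) / 2 \<le> order_bound d (size (S d))"
    by (rule bchoice[THEN exE])
  define Ts where "Ts = (\<Sum>d\<in>D. fst (z d))"
  define R where "R = (\<Sum>d\<in>D. snd (z d))"
  have sum_Ts: "\<Sum>\<^sub># Ts = (\<Sum>d\<in>D. \<Sum>\<^sub># (fst (z d)))"
    unfolding Ts_def using fin by (induction D rule: finite_induct) auto
  have "set_mset Ts = (\<Union>d\<in>D. set_mset (fst (z d)))" unfolding Ts_def using fin by (simp add: set_mset_sum)
  hence min_Ts: "\<forall>T\<in>#Ts. minimal_zero_sum n T" using z by auto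
  have B_split: "B = \<Sum>\<^sub># Ts + R"
    unfolding sum_Ts R_def sum.distrib[symmetric] unfolding B_eq using z by (intro sum.cong) auto
  have "zero_sum n (\<Sum>\<^sub># Ts)" using min_Ts
    by (induction Ts) (auto simp: minimal_zero_sum_def intro: zero_sum_union)
  hence "zero_sum n R" using B_split assms(3) zero_sum_union_iff by metis
  then obtain Us where U: "R = \<Sum>\<^sub># Us" "\<forall>T\<in>#Us. minimal_zero_sum n T" using factorization_exists by blast
  have "\<forall>T\<in>#Us. 2 \<le> size T"
  proof
    fix T assume T: "T \<in># Us"
    hence "set_mset T \<subseteq> set_mset B" using U(1) B_split by auto
    thus "2 \<le> size T" using minimal_zero_sum_size_ge2[of n T] U(2) T assms(2) by blast
  qed
  hence "2 * size Us \<le> size R" using size_sum_mset_ge[of Us 2] U(1) by simp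
  hence "real (size Us) \<le> real (size R) / 2" by simp
  hence "real (size (Ts + Us)) \<le> real (size Ts) + real (size R) / 2" by simp
  also have "\<dots> = (\<Sum>d\<in>D. real (size (fst (z d))) + real (size (snd (z d))) / 2)"
    by (simp add: Ts_def R_def sum.distrib sum_divide_distrib)
  also have "\<dots> \<le> (\<Sum>d\<in>D. order_bound d (size (S d)))" using z by (intro sum_mono) auto
  finally show ?thesis
    using B_split U min_Ts unfolding D_def S_def by (intro exI[of _ "Ts + Us"]) auto
qed

section \<open>Explicit upper bounds\<close>

text \<open>The value of \<^const>\<open>order_bound\<close> at \<open>s = n d\<close>, the largest possible number of residues of order \<open>d\<close> in
  the products that have to be factored.\<close>

definition level_bound :: "nat \<Rightarrow> nat \<Rightarrow> real" where
  "level_bound n d =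
     min (real n * real d / 2) (real n + (real d - 1) * (1 + 2 * ln (real d / 2)))"

lemma order_bound_le_level_bound:
  assumes "s \<le> n * d" "d \<ge> 2"
  shows "order_bound d s \<le> level_bound n d"
proof -
  have s: "real s \<le> real n * real d" using assms(1) by (metis of_nat_le_iff of_nat_mult)
  hence "real s / real d \<le> real n" using assms(2) by (simp add: field_simps)
  moreover have "real (d - 1) = real d - 1" using assms(2) by (simp add: of_nat_diff)
  ultimately show ?thesis using s unfolding order_bound_def level_bound_def
    by (intro min.mono) auto
qed

lemma level_bound_nonneg: "d \<ge> 2 \<Longrightarrow> 0 \<le> level_bound n d"
  by (auto simp: level_bound_def intro!: add_nonneg_nonneg mult_nonneg_nonneg)

text \<open>Consequently, the contribution \<open>n\<close> of the atoms removed from the given factorization is dominated by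
  the contribution of the new atoms.\<close>

lemma sum_level_bound_ge:
  assumes "n \<ge> 2"
  shows "real n - 1 \<le> (\<Sum>d | d dvd n \<and> 1 < d. level_bound n d)"
proof -
  have "real n \<le> real n * real n / 2" using assms by simp
  moreover have "0 \<le> (real n - 1) * (1 + 2 * ln (real n / 2))"
    using assms by (intro mult_nonneg_nonneg add_nonneg_nonneg) auto
  ultimately have "real n - 1 \<le> level_bound n n" by (simp add: level_bound_def)
  also have "\<dots> \<le> (\<Sum>d | d dvd n \<and> 1 < d. level_bound n d)"
    using assms by (intro member_le_sum) (auto intro: level_bound_nonneg)
  finally show ?thesis .
qed

text \<open>Only \<open>d = n\<close> contributes. The difference of the logarithms \<open>ln ((n + 3)/2)\<close> and \<open>ln (n/2)\<close> is at least
  \<open>3/(n + 3)\<close>, and this makes up for the excess of \<open>n\<close> over \<open>2(n - 1)n/(n + 5)\<close>, which is positive at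
  \<open>n = 5\<close>.\<close>

lemma sum_level_bound_prime:
  assumes "Factorial_Ring.prime (n::nat)" "n \<ge> 5"
  shows "(\<Sum>d | d dvd n \<and> 1 < d. level_bound n d) \<le>
     2 * (real n - 1) * real n / (real n + 5) + 2 * (real n - 1) * (1 / 2 + ln ((real n + 3) / 2))"
proof -
  have "{d. d dvd n \<and> 1 < d} = {n}" using assms by (auto simp: prime_nat_iff)
  hence "(\<Sum>d | d dvd n \<and> 1 < d. level_bound n d) = level_bound n n" by simp
  also have "\<dots> \<le> real n + (real n - 1) * (1 + 2 * ln (real n / 2))" by (simp add: level_bound_def)
  also have "\<dots> \<le> 2 * (real n - 1) * real n / (real n + 5) +
      2 * (real n - 1) * (1 / 2 + ln ((real n + 3) / 2))"
  proof -
    define x where "x = real n"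
    have x: "x \<ge> 5" using assms(2) by (simp add: x_def)
    have "ln (x / (x + 3)) \<le> x / (x + 3) - 1" using x by (intro ln_le_minus_one) auto
    also have "\<dots> = - (3 / (x + 3))" using x by (simp add: field_simps)
    finally have "3 / (x + 3) \<le> ln ((x + 3) / 2) - ln (x / 2)" using x by (simp add: ln_div)
    hence "2 * (x - 1) * (3 / (x + 3)) \<le> 2 * (x - 1) * (ln ((x + 3) / 2) - ln (x / 2))"
      using x by (intro mult_left_mono) auto
    moreover have "x \<le> 2 * (x - 1) * x / (x + 5) + 2 * (x - 1) * (3 / (x + 3))"
    proof -
      have "0 \<le> (x - 5) * (x * x + 7 * x)" using x by (intro mult_nonneg_nonneg) auto
      hence "0 \<le> (x - 5) * (x * x + 7 * x) + (38 * x - 30)" using x by linarith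
      hence "x * ((x + 5) * (x + 3)) \<le> 2 * (x - 1) * x * (x + 3) + 6 * (x - 1) * (x + 5)"
        by (simp add: algebra_simps)
      hence "x \<le> (2 * (x - 1) * x * (x + 3) + 6 * (x - 1) * (x + 5)) / ((x + 5) * (x + 3))"
        using x by (subst pos_le_divide_eq) auto
      also have "\<dots> = 2 * (x - 1) * x / (x + 5) + 2 * (x - 1) * (3 / (x + 3))"
        using x by (simp add: add_frac_eq algebra_simps)
      finally show ?thesis .
    qed
    ultimately show ?thesis unfolding x_def[symmetric] by (simp add: algebra_simps)
  qed
  finally show ?thesis .
qed

text \<open>The divisors \<open>p^i\<close> are estimated one by one; the terms \<open>2 p^i\<close> add up to the geometric series.\<close>

lemma sum_level_bound_prime_power:
  assumes "Factorial_Ring.prime (p::nat)" "n = p ^ \<alpha>" "\<alpha> \<ge> 1"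
  shows "(\<Sum>d | d dvd n \<and> 1 < d. level_bound n d) \<le>
     - 2 * real \<alpha> + 2 * real p ^ (\<alpha> + 1) / (real p - 1) + 2 * real \<alpha> * real n
       + 3 * (\<Sum>i = 1..\<alpha>. (real p ^ i - 1) * ln (real p ^ i / 2))"
proof -
  have p: "p \<ge> 2" using assms(1) by (rule prime_ge_2_nat)
  have D: "{d. d dvd n \<and> 1 < d} = (\<lambda>i. p ^ i) ` {1..\<alpha>}"
  proof (intro Set.set_eqI iffI)
    fix d assume d: "d \<in> {d. d dvd n \<and> 1 < d}"
    then obtain i where i: "i \<le> \<alpha>" "d = p ^ i" using divides_primepow_nat[OF assms(1)] assms(2) by auto
    hence "i \<noteq> 0" using d by (intro notI) simp
    thus "d \<in> (\<lambda>i. p ^ i) ` {1..\<alpha>}" using i by (intro image_eqI[of _ _ i]) auto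
  next
    fix d assume "d \<in> (\<lambda>i. p ^ i) ` {1..\<alpha>}"
    then obtain i where i: "d = p ^ i" "1 \<le> i" "i \<le> \<alpha>" by auto
    have "1 < p ^ i" using p i by (intro one_less_power) auto
    thus "d \<in> {d. d dvd n \<and> 1 < d}" using i by (simp add: assms(2) le_imp_power_dvd)
  qed
  have inj: "inj_on (\<lambda>i. p ^ i) {1..\<alpha>}" using p by (auto intro!: inj_onI dest: power_inject_exp[THEN iffD1, rotated])
  have "(\<Sum>d | d dvd n \<and> 1 < d. level_bound n d) = (\<Sum>i = 1..\<alpha>. level_bound n (p ^ i))"
    unfolding D by (subst sum.reindex[OF inj]) simp
  also have "\<dots> \<le> (\<Sum>i = 1..\<alpha>. 2 * (real p ^ i - 1) + 2 * real n + 3 * ((real p ^ i - 1) * ln (real p ^ i / 2)))"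
  proof (intro sum_mono)
    fix i assume i: "i \<in> {1..\<alpha>}"
    define y where "y = real p ^ i"
    have "real p ^ 1 \<le> real p ^ i" using i p by (intro power_increasing) auto
    hence "real p \<le> y" by (simp only: power_one_right y_def)
    hence y: "y \<ge> 2" using p by linarith
    have "level_bound n (p ^ i) \<le> real n + (y - 1) * (1 + 2 * ln (y / 2))"
      by (simp add: level_bound_def y_def)
    also have "\<dots> \<le> 2 * (y - 1) + 2 * real n + 3 * ((y - 1) * ln (y / 2))"
    proof -
      have "0 \<le> (y - 1) * ln (y / 2)" using y by simp
      thus ?thesis using y by (simp add: algebra_simps)
    qed
    finally show "level_bound n (p ^ i) \<le>
        2 * (real p ^ i - 1) + 2 * real n + 3 * ((real p ^ i - 1) * ln (real p ^ i / 2))"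
      by (simp add: y_def)
  qed
  also have "\<dots> = 2 * (\<Sum>i = 1..\<alpha>. real p ^ i) - 2 * real \<alpha> + 2 * real \<alpha> * real n
      + 3 * (\<Sum>i = 1..\<alpha>. (real p ^ i - 1) * ln (real p ^ i / 2))"
    by (simp add: sum.distrib sum_distrib_left sum_subtractf algebra_simps)
  also have "(\<Sum>i = 1..\<alpha>. real p ^ i) \<le> real p ^ (\<alpha> + 1) / (real p - 1)"
  proof -
    have "(\<Sum>i = 1..\<alpha>. real p ^ i) \<le> (\<Sum>i<\<alpha> + 1. real p ^ i)" by (intro sum_mono2) auto
    also have "\<dots> = (real p ^ (\<alpha> + 1) - 1) / (real p - 1)" using p by (intro geometric_sum) auto
    also have "\<dots> \<le> real p ^ (\<alpha> + 1) / (real p - 1)" using p by (intro divide_right_mono) auto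
    finally show ?thesis .
  qed
  finally show ?thesis by (simp add: algebra_simps)
qed

text \<open>Here \<open>ln\<close> is extended to negative numbers by \<open>ln x = ln \<bar>x\<bar>\<close>, with \<open>ln 0 = 0\<close>.\<close>

lemma ln_of_int_nonneg: "0 \<le> ln (real_of_int k)"
proof (cases "k \<le> 0")
  case True
  hence "ln (real_of_int k) = ln \<bar>real_of_int k\<bar>" by (simp add: ln_real_def)
  thus ?thesis using True by (cases "k = 0") auto
qed auto

text \<open>Let \<open>f\<close> be the floor in the logarithm. Then \<open>d\<close> is at most \<open>3f(K + 1)\<close>, or \<open>3(K + 1)\<close> if \<open>f \<le> 0\<close>, so
  \<open>2 ln (d/2)\<close> exceeds \<open>2 ln f\<close> by at most \<open>2 ln (3(K + 1)/2)\<close>. This is at most \<open>K + 3/20\<close> for \<open>K \<ge> 4\<close>, and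
  \<open>(d - 1) K\<close> is covered by \<open>n K'\<close>.\<close>

lemma large_level_bound:
  fixes K K' :: real
  assumes "d \<ge> 2" "d \<le> n" "4 \<le> K" "K \<le> K'"
  shows "level_bound n d \<le> 4.3 / 2 * (real d - 1) + real n * K' +
           3.3 * ((real d - 1) * ln (real_of_int \<lfloor>(real d + 1) / (K + 1) - 1\<rfloor>))"
proof -
  define f where "f = \<lfloor>(real d + 1) / (K + 1) - 1\<rfloor>"
  have f0: "0 \<le> ln (real_of_int f)" by (rule ln_of_int_nonneg)
  have ln32: "2 * ln (3 / 2 * (K + 1)) \<le> K + 3 / 20"
  proof -
    have "ln (3 / 2 * (K + 1) * (2 / 15)) \<le> 3 / 2 * (K + 1) * (2 / 15) - 1"
      using assms(3) by (intro ln_le_minus_one) auto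
    moreover have "ln (3 / 2 * (K + 1) * (2 / 15)) = ln (3 / 2 * (K + 1)) + ln (2 / 15)"
      using assms(3) by (intro ln_mult_pos) auto
    moreover have "ln (2 / 15 :: real) = - ln (15 / 2)" by (simp add: ln_div)
    moreover have "ln (15 / 2 :: real) \<le> 2.07"
    proof -
      have "1 + 207 / 800 + (207 / 800)\<^sup>2 / 2 \<le> exp (207 / 800 :: real)"
        by (rule exp_lower_Taylor_quadratic) simp
      hence "(1 + 207 / 800 + (207 / 800)\<^sup>2 / 2) ^ 8 \<le> exp (207 / 800 :: real) ^ 8"
        by (intro power_mono) auto
      also have "\<dots> = exp 2.07" by (simp flip: exp_of_nat_mult)
      finally have "15 / 2 \<le> exp (2.07 :: real)" by (simp add: field_simps)
      hence "ln (15 / 2) \<le> ln (exp (2.07 :: real))" by (subst ln_le_cancel_iff) auto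
      thus ?thesis by (simp only: ln_exp)
    qed
    ultimately show ?thesis using assms(3) by (simp add: field_simps)
  qed
  have key: "2 * ln (real d / 2) \<le> K + 3 / 20 + 3.3 * ln (real_of_int f)"
  proof (cases "f \<ge> 1")
    case True
    have "(real d + 1) / (K + 1) - 1 < real_of_int f + 1" unfolding f_def by linarith
    hence "(real d + 1) / (K + 1) < 3 * real_of_int f" using True by linarith
    hence "real d < 3 * real_of_int f * (K + 1)" using assms(3) by (simp add: divide_less_eq)
    hence "real d / 2 \<le> real_of_int f * (3 / 2 * (K + 1))" by (simp add: algebra_simps)
    hence "ln (real d / 2) \<le> ln (real_of_int f * (3 / 2 * (K + 1)))"
      using assms(1) by (intro ln_mono) auto
    also have "\<dots> = ln (real_of_int f) + ln (3 / 2 * (K + 1))"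
      using True assms(3) by (intro ln_mult_pos) auto
    finally show ?thesis using ln32 f0 by linarith
  next
    case False
    hence "(real d + 1) / (K + 1) - 1 < 1" unfolding f_def by linarith
    hence "real d \<le> 3 * (K + 1)" using assms(3) by (simp add: field_simps)
    hence "ln (real d / 2) \<le> ln (3 / 2 * (K + 1))" using assms(1) by (subst ln_le_cancel_iff) auto
    thus ?thesis using ln32 f0 by linarith
  qed
  have "level_bound n d \<le> real n + (real d - 1) * (1 + 2 * ln (real d / 2))"
    by (simp add: level_bound_def)
  also have "\<dots> \<le> real n + (real d - 1) * (1 + (K + 3 / 20 + 3.3 * ln (real_of_int f)))"
    using assms(1) key by (intro add_left_mono mult_left_mono) auto
  also have "\<dots> = real n + (real d - 1) * (K - 1) + 4.3 / 2 * (real d - 1)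
      + 3.3 * ((real d - 1) * ln (real_of_int f))"
    by (simp add: field_simps)
  also have "(real d - 1) * (K - 1) \<le> real n * (K' - 1)"
    using assms by (intro mult_mono) auto
  finally show ?thesis unfolding f_def[symmetric] by (simp add: algebra_simps)
qed

text \<open>Small divisors are handled by the trivial term \<open>nd/2\<close> of the level bound, large ones by the preceding
  lemma with \<open>K = 2^(\<omega> + 1) sqrt (2\<omega> - 1)\<close>, where \<open>\<omega>\<close> is the number of prime divisors of \<open>d\<close>;
  \<open>K \<ge> 4\<close> holds because \<open>\<omega> \<ge> 1\<close>.\<close>

lemma sum_level_bound_general:
  assumes "n > 0"
  shows "(\<Sum>d | d dvd n \<and> 1 < d. level_bound n d) \<le>
     4.3 / 2 * (\<Sum>d | d dvd n \<and> 1 < d. real d - 1)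
       + real n * (\<Sum>d | d dvd n \<and> 1 < d \<and> d \<le> 4375. real d / 2)
       + real n * (\<Sum>d | d dvd n \<and> 4376 \<le> d.
           2 ^ (num_prime_divisors d + 1) * sqrt (2 * real (num_prime_divisors d)))
       + 3.3 * (\<Sum>d | d dvd n \<and> 4376 \<le> d.
           (real d - 1) *
           ln (real_of_int
             \<lfloor>(real d + 1) / (2 ^ (num_prime_divisors d + 1)
                 * sqrt (2 * real (num_prime_divisors d) - 1) + 1) - 1\<rfloor>))"
proof -
  define A where "A = {d. d dvd n \<and> 1 < d}"
  define B where "B = {d. d dvd n \<and> 1 < d \<and> d \<le> 4375}"
  define C where "C = {d. d dvd n \<and> 4376 \<le> d}"
  define K' where "K' d = 2 ^ (num_prime_divisors d + 1) * sqrt (2 * real (num_prime_divisors d))" for d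
  define K where "K d = 2 ^ (num_prime_divisors d + 1) * sqrt (2 * real (num_prime_divisors d) - 1)" for d
  define lg where "lg d = ln (real_of_int \<lfloor>(real d + 1) / (K d + 1) - 1\<rfloor>)" for d
  have fin: "finite B" "finite C" using assms by (auto simp: B_def C_def)
  have ABC: "A = B \<union> C" "B \<inter> C = {}" by (auto simp: A_def B_def C_def)
  have B: "level_bound n d \<le> 4.3 / 2 * (real d - 1) + real n * (real d / 2)" if "d \<in> B" for d
  proof -
    have "level_bound n d \<le> real n * real d / 2"
      unfolding level_bound_def by (rule min.cobounded1)
    hence "level_bound n d \<le> real n * (real d / 2)" by simp
    moreover have "0 \<le> 4.3 / 2 * (real d - 1)" using that by (simp add: B_def)
    ultimately show ?thesis by linarith
  qed
  have C: "level_bound n d \<le> 4.3 / 2 * (real d - 1) + real n * K' d + 3.3 * ((real d - 1) * lg d)"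
    if "d \<in> C" for d
  proof -
    have d: "d dvd n" "4376 \<le> d" using that by (auto simp: C_def)
    hence dn: "d \<le> n" using assms by (simp add: dvd_imp_le)
    obtain q where "Factorial_Ring.prime q" "q dvd d" using d(2) by (metis prime_factor_nat numeral_One numeral_le_iff semiring_norm(69))
    hence "q \<in> prime_factors d" using d(2) by (simp add: prime_factors_dvd)
    hence w: "num_prime_divisors d \<ge> 1"
      unfolding num_prime_divisors_def by (metis card_gt_0_iff empty_iff finite_set_mset One_nat_def Suc_leI)
    have "2 ^ 2 * (1::real) \<le> 2 ^ (num_prime_divisors d + 1) * sqrt (2 * real (num_prime_divisors d) - 1)"
      using w by (intro mult_mono power_increasing) auto
    hence "4 \<le> K d" by (simp add: K_def)
    moreover have "K d \<le> K' d" by (simp add: K_def K'_def)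
    ultimately show ?thesis unfolding lg_def using large_level_bound[of d n "K d" "K' d"] d(2) dn by simp
  qed
  have "(\<Sum>d\<in>A. level_bound n d) = (\<Sum>d\<in>B. level_bound n d) + (\<Sum>d\<in>C. level_bound n d)"
    unfolding ABC(1) using fin ABC(2) by (rule sum.union_disjoint)
  also have "\<dots> \<le> (\<Sum>d\<in>B. 4.3 / 2 * (real d - 1) + real n * (real d / 2)) +
      (\<Sum>d\<in>C. 4.3 / 2 * (real d - 1) + real n * K' d + 3.3 * ((real d - 1) * lg d))"
    using B C by (intro add_mono sum_mono) auto
  also have "\<dots> = 4.3 / 2 * ((\<Sum>d\<in>B. real d - 1) + (\<Sum>d\<in>C. real d - 1)) + real n * (\<Sum>d\<in>B. real d / 2)
      + real n * (\<Sum>d\<in>C. K' d) + 3.3 * (\<Sum>d\<in>C. (real d - 1) * lg d)"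
    unfolding sum.distrib sum_distrib_left[symmetric] by (simp only: distrib_left)
  also have "(\<Sum>d\<in>B. real d - 1) + (\<Sum>d\<in>C. real d - 1) = (\<Sum>d\<in>A. real d - 1)"
    unfolding ABC(1) using fin ABC(2) by (rule sum.union_disjoint[symmetric])
  finally show ?thesis unfolding A_def B_def C_def lg_def K_def K'_def .
qed

section \<open>Divisor theories with cyclic class group\<close>

lemma lookup_frag_of_mset: "poly_mapping.lookup (frag_of_mset m) p = int (count m p)"
  unfolding frag_of_mset_def
  by (induction m) (auto simp: lookup_add)

lemma frag_of_mset_add: "frag_of_mset (m + m') = frag_of_mset m + frag_of_mset m'"
  by (simp add: frag_of_mset_def)

lemma frag_of_mset_inject: "frag_of_mset m = frag_of_mset m' \<longleftrightarrow> m = m'"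
  by (metis lookup_frag_of_mset multiset_eqI of_nat_eq_iff)

lemma keys_frag_of_mset: "Poly_Mapping.keys (frag_of_mset m) = set_mset m"
  by (auto simp: in_keys_iff lookup_frag_of_mset)

context krull_monoid
begin

lemma phi_in_P: "a \<in> carrier H \<Longrightarrow> set_mset (\<phi> a) \<subseteq> P"
  using divisor_theory
  by (auto simp: divisor_theory_def divisor_homomorphism_def free_abelian_monoid_def hom_def)

lemma phi_mult: "a \<in> carrier H \<Longrightarrow> b \<in> carrier H \<Longrightarrow> \<phi> (a \<otimes> b) = \<phi> a + \<phi> b"
  using divisor_theory
  by (auto simp: divisor_theory_def divisor_homomorphism_def free_abelian_monoid_def hom_def)

lemma phi_one: "\<phi> \<one> = {#}"
  using divisor_theory
  by (auto simp: divisor_theory_def divisor_homomorphism_def free_abelian_monoid_def)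

lemma phi_subset_imp_divides:
  assumes "a \<in> carrier H" "b \<in> carrier H" "\<phi> a \<subseteq># \<phi> b"
  shows "a divides b"
proof -
  have "\<phi> a divides\<^bsub>free_abelian_monoid P\<^esub> \<phi> b"
  proof (rule dividesI)
    show "\<phi> b - \<phi> a \<in> carrier (free_abelian_monoid P)"
      using phi_in_P[OF assms(2)] by (auto simp: free_abelian_monoid_def dest: in_diffD)
    show "\<phi> b = \<phi> a \<otimes>\<^bsub>free_abelian_monoid P\<^esub> (\<phi> b - \<phi> a)"
      using assms(3) by (simp add: free_abelian_monoid_def)
  qed
  thus ?thesis using divisor_theory assms(1,2)
    by (auto simp: divisor_theory_def divisor_homomorphism_def)
qed

text \<open>If \<open>\<phi> b\<close> divides \<open>\<phi> a\<close>, then \<open>b\<close> divides \<open>a\<close> in \<open>H\<close>, and the quotient in \<open>H\<close> is mapped to the quotient in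
  the free monoid.\<close>

lemma image_phi_diff:
  assumes "m + m' = \<phi> a" "m' = \<phi> b" "a \<in> carrier H" "b \<in> carrier H"
  shows "m \<in> \<phi> ` carrier H"
proof -
  have "\<phi> b \<subseteq># \<phi> a" unfolding assms(1)[symmetric] assms(2)[symmetric] by simp
  hence "b divides a" using assms(3,4) by (intro phi_subset_imp_divides)
  then obtain c where c: "c \<in> carrier H" "a = b \<otimes> c" by blast
  hence "m = \<phi> c" using assms phi_mult[of b c] by auto
  thus ?thesis using c by blast
qed

text \<open>Fix a generator \<open>x\<close> of the class group and let \<open>x^(\<kappa> p)\<close> be the class of \<open>p\<close>. Then the class of \<open>m\<close> is
  \<open>x^k\<close> with \<open>k\<close> the sum of the values \<open>\<kappa> p\<close>, and it is trivial iff \<open>m\<close> is a quotient of two elements of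
  \<open>\<phi>(H)\<close>, which means \<open>m \<in> \<phi>(H)\<close>.\<close>

lemma class_function_exists:
  assumes "cyclic_group (class_group H P \<phi>)" "order (class_group H P \<phi>) = n" "n > 0"
  obtains \<kappa> :: "'p \<Rightarrow> int" where "\<And>p. 0 \<le> \<kappa> p \<and> \<kappa> p < int n"
    "\<And>m. set_mset m \<subseteq> P \<Longrightarrow> m \<in> \<phi> ` carrier H \<longleftrightarrow> zero_sum n (image_mset \<kappa> m)"
proof -
  define F where "F = free_Abelian_group P"
  define N where "N = {frag_of_mset (\<phi> a) - frag_of_mset (\<phi> b) | a b. a \<in> carrier H \<and> b \<in> carrier H}"
  interpret F: comm_group F unfolding F_def by (rule abelian_free_Abelian_group)
  have keysF: "c \<in> carrier F \<longleftrightarrow> Poly_Mapping.keys c \<subseteq> P" for c by (simp add: F_def)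
  have multF: "c \<otimes>\<^bsub>F\<^esub> c' = c + c'" for c c' by (simp add: F_def)
  have oneF: "\<one>\<^bsub>F\<^esub> = 0" by (simp add: F_def)
  have NF: "N \<subseteq> carrier F"
  proof
    fix c assume "c \<in> N"
    then obtain a b where ab: "c = frag_of_mset (\<phi> a) - frag_of_mset (\<phi> b)" "a \<in> carrier H" "b \<in> carrier H"
      by (auto simp: N_def)
    have "Poly_Mapping.keys c \<subseteq> set_mset (\<phi> a) \<union> set_mset (\<phi> b)"
      unfolding ab(1) using keys_diff[of "frag_of_mset (\<phi> a)" "frag_of_mset (\<phi> b)"]
      by (simp add: keys_frag_of_mset)
    thus "c \<in> carrier F" using phi_in_P ab(2,3) unfolding keysF by blast
  qed
  have subN: "subgroup N F"
  proof (rule F.subgroupI[OF NF])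
    show "N \<noteq> {}" unfolding N_def by blast
    fix c assume c: "c \<in> N"
    then obtain a b where ab: "c = frag_of_mset (\<phi> a) - frag_of_mset (\<phi> b)" "a \<in> carrier H" "b \<in> carrier H"
      by (auto simp: N_def)
    have "Poly_Mapping.keys c \<subseteq> P" using c NF keysF by blast
    hence "inv\<^bsub>F\<^esub> c = - c" unfolding F_def by (rule inv_free_Abelian_group)
    also have "\<dots> = frag_of_mset (\<phi> b) - frag_of_mset (\<phi> a)" using ab by simp
    finally show "inv\<^bsub>F\<^esub> c \<in> N" using ab unfolding N_def by blast
    fix c' assume c': "c' \<in> N"
    then obtain a' b' where ab': "c' = frag_of_mset (\<phi> a') - frag_of_mset (\<phi> b')" "a' \<in> carrier H" "b' \<in> carrier H"
      by (auto simp: N_def)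
    have "c + c' = frag_of_mset (\<phi> (a \<otimes> a')) - frag_of_mset (\<phi> (b \<otimes> b'))"
      using ab ab' by (simp add: phi_mult frag_of_mset_add)
    thus "c \<otimes>\<^bsub>F\<^esub> c' \<in> N" unfolding multF N_def using ab ab' by blast
  qed
  interpret N: normal N F using subN by (rule F.subgroup_imp_normal)
  define Q where "Q = F Mod N"
  have Q: "Q = class_group H P \<phi>" by (simp add: Q_def class_group_def F_def N_def)
  interpret Q: group Q unfolding Q_def by (rule N.factorgroup_is_group)
  define cls where "cls c = N #>\<^bsub>F\<^esub> c" for c
  have cls_hom: "cls \<in> hom F Q" unfolding cls_def[abs_def] Q_def by (rule N.r_coset_hom_Mod)
  obtain x where x: "x \<in> carrier Q" "carrier Q = range (\<lambda>k::int. x [^]\<^bsub>Q\<^esub> k)"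
    using assms(1) unfolding Q[symmetric] Q.cyclic_group by blast
  have "Q.ord x = card (generate Q {x})" by (rule Q.generate_pow_card[OF x(1)])
  also have "generate Q {x} = carrier Q" unfolding Q.generate_pow[OF x(1)] x(2) by blast
  finally have ord: "Q.ord x = n" using assms(2) by (simp add: Q order_def)
  define \<kappa> where "\<kappa> p = (SOME k::int. cls (frag_of p) = x [^]\<^bsub>Q\<^esub> k) mod int n" for p
  have \<kappa>: "cls (frag_of p) = x [^]\<^bsub>Q\<^esub> \<kappa> p" if "p \<in> P" for p
  proof -
    have "frag_of p \<in> carrier F" using that by (simp add: keysF)
    hence "cls (frag_of p) \<in> carrier Q" using cls_hom by (auto simp: hom_def)
    hence "\<exists>k::int. cls (frag_of p) = x [^]\<^bsub>Q\<^esub> k" unfolding x(2) by blast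
    hence "cls (frag_of p) = x [^]\<^bsub>Q\<^esub> (SOME k::int. cls (frag_of p) = x [^]\<^bsub>Q\<^esub> k)" by (rule someI_ex)
    also have "\<dots> = x [^]\<^bsub>Q\<^esub> \<kappa> p"
      unfolding \<kappa>_def Q.int_pow_eq[OF x(1)] ord by (simp add: mod_eq_dvd_iff[symmetric])
    finally show ?thesis .
  qed
  have cls_mset: "cls (frag_of_mset m) = x [^]\<^bsub>Q\<^esub> (\<Sum>\<^sub># (image_mset \<kappa> m))" if "set_mset m \<subseteq> P" for m
    using that
  proof (induction m)
    case empty
    have "cls (frag_of_mset {#}) = \<one>\<^bsub>Q\<^esub>"
      using hom_one[OF cls_hom F.is_group Q.is_group] by (simp add: frag_of_mset_def oneF)
    thus ?case by simp
  next
    case (add p m)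
    have c: "frag_of p \<in> carrier F" "frag_of_mset m \<in> carrier F"
      using add.prems by (auto simp: keysF keys_frag_of_mset)
    have "frag_of_mset (add_mset p m) = frag_of p \<otimes>\<^bsub>F\<^esub> frag_of_mset m"
      by (simp add: frag_of_mset_def multF)
    hence "cls (frag_of_mset (add_mset p m)) = cls (frag_of p) \<otimes>\<^bsub>Q\<^esub> cls (frag_of_mset m)"
      using hom_mult[OF cls_hom c] by simp
    also have "\<dots> = x [^]\<^bsub>Q\<^esub> \<kappa> p \<otimes>\<^bsub>Q\<^esub> x [^]\<^bsub>Q\<^esub> (\<Sum>\<^sub># (image_mset \<kappa> m))"
      using add by (simp add: \<kappa>)
    finally show ?case using x(1) by (simp add: Q.int_pow_mult)
  qed
  have img: "m \<in> \<phi> ` carrier H \<longleftrightarrow> zero_sum n (image_mset \<kappa> m)" if m: "set_mset m \<subseteq> P" for m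
  proof -
    have mF: "frag_of_mset m \<in> carrier F" using m by (simp add: keysF keys_frag_of_mset)
    have "zero_sum n (image_mset \<kappa> m) \<longleftrightarrow> cls (frag_of_mset m) = \<one>\<^bsub>Q\<^esub>"
      unfolding cls_mset[OF m] zero_sum_def Q.int_pow_eq_id[OF x(1)] ord by simp
    also have "\<dots> \<longleftrightarrow> N #>\<^bsub>F\<^esub> frag_of_mset m = N" by (simp add: cls_def Q_def)
    also have "\<dots> \<longleftrightarrow> frag_of_mset m \<in> N"
      using F.coset_join1[OF _ mF subN] F.coset_join2[OF mF subN] by blast
    also have "\<dots> \<longleftrightarrow> m \<in> \<phi> ` carrier H"
    proof
      assume "frag_of_mset m \<in> N"
      then obtain a b where ab: "frag_of_mset m = frag_of_mset (\<phi> a) - frag_of_mset (\<phi> b)"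
          "a \<in> carrier H" "b \<in> carrier H" by (auto simp: N_def)
      hence "frag_of_mset (m + \<phi> b) = frag_of_mset (\<phi> a)" by (simp add: frag_of_mset_add)
      hence "m + \<phi> b = \<phi> a" by (simp only: frag_of_mset_inject)
      from image_phi_diff[OF this refl ab(2,3)] show "m \<in> \<phi> ` carrier H" .
    next
      assume "m \<in> \<phi> ` carrier H"
      then obtain a where "a \<in> carrier H" "m = \<phi> a" by blast
      moreover have "frag_of_mset (\<phi> \<one>) = 0" by (simp add: phi_one frag_of_mset_def)
      ultimately have "frag_of_mset m = frag_of_mset (\<phi> a) - frag_of_mset (\<phi> \<one>)" by simp
      thus "frag_of_mset m \<in> N" unfolding N_def using \<open>a \<in> carrier H\<close> by blast
    qed
    finally show ?thesis by (rule sym)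
  qed
  have range: "0 \<le> \<kappa> p \<and> \<kappa> p < int n" for p using assms(3) by (simp add: \<kappa>_def)
  show ?thesis using range img by (rule that)
qed

end


section \<open>Exchanging atoms in a factorization\<close>

lemma lift_factorization:
  assumes "image_mset f V = \<Sum>\<^sub># Ts"
  shows "\<exists>W. V = \<Sum>\<^sub># W \<and> Ts = image_mset (image_mset f) W"
  using assms
proof (induction Ts arbitrary: V)
  case empty
  thus ?case by (intro exI[of _ "{#}"]) auto
next
  case (add T Ts)
  from add.prems have "image_mset f V = T + \<Sum>\<^sub># Ts" by simp
  then obtain A B where AB: "V = A + B" "T = image_mset f A" "\<Sum>\<^sub># Ts = image_mset f B"
    using image_mset_eq_plusD by blast
  from add.IH[OF AB(3)[symmetric]] obtain W where "B = \<Sum>\<^sub># W" "Ts = image_mset (image_mset f) W"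
    by blast
  thus ?case using AB by (intro exI[of _ "add_mset A W"]) auto
qed

text \<open>Minimality of the multiset of classes passes to the multiset of primes, because sizes are preserved.\<close>

lemma minimal_image_unique:
  assumes "minimal_zero_sum n (image_mset f U)" "T \<subseteq># U" "zero_sum n (image_mset f T)" "T \<noteq> {#}"
  shows "T = U"
proof -
  have "image_mset f T = image_mset f U"
    using assms(1,3,4) image_mset_subseteq_mono[OF assms(2), of f]
    unfolding minimal_zero_sum_def by (metis image_mset_is_empty_iff)
  hence "size T = size U" by (metis size_image_mset)
  thus ?thesis using assms(2) by (metis mset_subset_size nless_le subset_mset.less_le)
qed

text \<open>Distribute \<open>U\<close> over the factors and keep only those factors that receive some element of \<open>U\<close>. That each
  kept factor meets \<open>U\<close> is used to exclude primes of trivial class.\<close>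

lemma covering_subproduct:
  assumes "U \<subseteq># \<Sum>\<^sub># Z"
  shows "\<exists>I. I \<subseteq># Z \<and> size I \<le> size U \<and> U \<subseteq># \<Sum>\<^sub># I \<and> (\<forall>A\<in>#I. \<exists>p. p \<in># A \<and> p \<in># U)"
  using assms
proof (induction Z arbitrary: U)
  case empty
  thus ?case by auto
next
  case (add A Z)
  have "U - A \<subseteq># \<Sum>\<^sub># Z"
    using add.prems by (simp add: subset_eq_diff_conv add.commute)
  from add.IH[OF this] obtain I where I: "I \<subseteq># Z" "size I \<le> size (U - A)" "U - A \<subseteq># \<Sum>\<^sub># I"
      "\<forall>B\<in>#I. \<exists>p. p \<in># B \<and> p \<in># U - A" by blast
  have IU: "\<forall>B\<in>#I. \<exists>p. p \<in># B \<and> p \<in># U" using I(4) by (meson in_diffD)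
  show ?case
  proof (cases "U \<inter># A = {#}")
    case True
    have "U - A = U"
    proof (rule multiset_eqI)
      fix x
      have "count (U \<inter># A) x = 0" using True by simp
      thus "count (U - A) x = count U x" by (auto simp: min_def split: if_splits)
    qed
    thus ?thesis using I IU by (intro exI[of _ I]) (auto intro: subset_mset.order_trans)
  next
    case False
    then obtain p where p: "p \<in># U" "p \<in># A" by (metis multiset_nonemptyE set_mset_inter IntE)
    have "count (U - A) p < count U p" using p by (metis count_diff count_greater_zero_iff diff_less)
    hence "U - A \<noteq> U" by (metis less_irrefl)
    hence "U - A \<subset># U" by (simp add: subset_mset.less_le)
    hence "size (U - A) < size U" by (rule mset_subset_size)
    moreover have "U \<subseteq># A + \<Sum>\<^sub># I" using I(3) by (simp add: subset_eq_diff_conv add.commute)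
    ultimately show ?thesis using I(1,2) IU p by (intro exI[of _ "add_mset A I"]) auto
  qed
qed

text \<open>If \<open>U\<close> is not already a factor, then the selected factors contain no prime of class zero: such a prime
  would be an entire factor and, meeting \<open>U\<close>, it would equal \<open>U\<close>. By minimality a factor contains at
  most \<open>d\<close> residues killed by \<open>d\<close>, so at most \<open>n d\<close> residues of order \<open>d\<close> remain after division by \<open>U\<close>, and
  \<open>short_factorization\<close> applies.\<close>

lemma exchange_factorization:
  fixes \<kappa> :: "'p \<Rightarrow> int"
  assumes n: "n \<ge> 2"
    and \<kappa>: "\<And>p. 0 \<le> \<kappa> p \<and> \<kappa> p < int n"
    and Z: "\<forall>A\<in>#Z. minimal_zero_sum n (image_mset \<kappa> A)"
    and U: "minimal_zero_sum n (image_mset \<kappa> U)" "U \<subseteq># \<Sum>\<^sub># Z"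
  shows "\<exists>I W. I \<subseteq># Z \<and> \<Sum>\<^sub># I = U + \<Sum>\<^sub># W \<and> (\<forall>A\<in>#W. minimal_zero_sum n (image_mset \<kappa> A)) \<and>
           real (size I) \<le> real n \<and>
           real (size W) \<le> (\<Sum>d | d dvd n \<and> 1 < d. level_bound n d)"
proof (cases "U \<in># Z")
  case True
  thus ?thesis using n sum_level_bound_ge[OF n] by (intro exI[of _ "{#U#}"] exI[of _ "{#}"]) auto
next
  case False
  have n0: "n > 0" using n by simp
  have few: "size (filter_mset (\<lambda>p. \<kappa> p \<in> torsion n d) A) \<le> d"
    if "minimal_zero_sum n (image_mset \<kappa> A)" "d dvd n" for A d
  proof (rule ccontr)
    assume big: "\<not> ?thesis"
    define B where "B = filter_mset (\<lambda>p. \<kappa> p \<in> torsion n d) A"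
    have B: "d \<le> size (image_mset \<kappa> B)" "d < size B" using big by (auto simp: B_def)
    have "set_mset (image_mset \<kappa> B) \<subseteq> torsion n d" by (auto simp: B_def)
    from short_zero_sum[OF that(2) n0 this B(1)] obtain T where T: "T \<subseteq># image_mset \<kappa> B" "T \<noteq> {#}"
        "zero_sum n T" "size T \<le> d" by blast
    then obtain C where C: "C \<subseteq># B" "T = image_mset \<kappa> C"
      by (metis image_mset_eq_plusD mset_subset_eq_add_left subset_mset.add_diff_inverse)
    have "C \<subseteq># A" using C(1) unfolding B_def by (meson multiset_filter_subset subset_mset.order_trans)
    hence "C = A" using minimal_image_unique[OF that(1)] T C by auto
    hence "size A \<le> d" using T(4) C(2) by simp
    moreover have "size B \<le> size A" unfolding B_def by (simp add: size_mset_mono)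
    ultimately show False using B(2) by linarith
  qed
  have "filter_mset (\<lambda>p. \<kappa> p \<in> torsion n n) U = U"
    using \<kappa> by (auto simp: torsion_def filter_mset_eq_conv)
  hence sizeU: "size U \<le> n" using few[OF U(1), of n] by simp
  obtain I where I: "I \<subseteq># Z" "size I \<le> size U" "U \<subseteq># \<Sum>\<^sub># I" "\<forall>A\<in>#I. \<exists>p. p \<in># A \<and> p \<in># U"
    using covering_subproduct[OF U(2)] by blast
  have I_min: "minimal_zero_sum n (image_mset \<kappa> A)" if "A \<in># I" for A
    using Z mset_subset_eqD[OF I(1) that] by blast
  define V where "V = \<Sum>\<^sub># I - U"
  have V: "\<Sum>\<^sub># I = U + V" using I(3) by (simp add: V_def)
  have nonzero: "\<kappa> p > 0" if p: "p \<in># \<Sum>\<^sub># I" for p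
  proof (rule ccontr)
    assume "\<not> ?thesis"
    hence p0: "zero_sum n (image_mset \<kappa> {#p#})" using \<kappa>[of p] by (simp add: zero_sum_def)
    obtain A where A: "A \<in># I" "p \<in># A" using p by auto
    hence "{#p#} = A" using minimal_image_unique[OF I_min[OF A(1)] _ p0] by simp
    hence "p \<in># U" using I(4) A(1) by auto
    hence "{#p#} = U" using minimal_image_unique[OF U(1) _ p0] by simp
    thus False using \<open>{#p#} = A\<close> A(1) I(1) False by (auto dest: mset_subset_eqD)
  qed
  have zsI: "zero_sum n (image_mset \<kappa> (\<Sum>\<^sub># J))" if "\<forall>A\<in>#J. minimal_zero_sum n (image_mset \<kappa> A)" for J
    using that by (induction J) (auto simp: minimal_zero_sum_def intro: zero_sum_union)
  have "zero_sum n (image_mset \<kappa> (U + V))" using zsI[of I] I_min V by auto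
  hence "zero_sum n (image_mset \<kappa> V)" using U(1) by (simp add: minimal_zero_sum_def zero_sum_union_iff)
  moreover have "\<forall>x\<in>#image_mset \<kappa> V. 0 < x \<and> x < int n" using nonzero \<kappa> V by auto
  ultimately obtain Ts where Ts: "image_mset \<kappa> V = \<Sum>\<^sub># Ts" "\<forall>T\<in>#Ts. minimal_zero_sum n T"
      "real (size Ts) \<le> (\<Sum>d | d dvd n \<and> 1 < d.
         order_bound d (size (filter_mset (\<lambda>x. x \<in> residues_of_order n d) (image_mset \<kappa> V))))"
    using short_factorization[OF n0] by blast
  obtain W where W: "V = \<Sum>\<^sub># W" "Ts = image_mset (image_mset \<kappa>) W"
    using lift_factorization[OF Ts(1)] by blast
  have level: "size (filter_mset (\<lambda>x. x \<in> residues_of_order n d) (image_mset \<kappa> V)) \<le> n * d"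
    if d: "d dvd n" for d
  proof -
    define q where "q = (\<lambda>p. \<kappa> p \<in> torsion n d)"
    have "size (filter_mset (\<lambda>x. x \<in> residues_of_order n d) (image_mset \<kappa> V))
        = size (filter_mset (\<lambda>p. \<kappa> p \<in> residues_of_order n d) V)"
      by (simp add: filter_mset_image_mset)
    also have "\<dots> \<le> size (filter_mset q V)"
      using residues_of_order_torsion[OF n0] unfolding q_def
      by (intro size_mset_mono mset_subset_eqI) auto
    also have "\<dots> \<le> size (filter_mset q (\<Sum>\<^sub># I))" by (simp add: V)
    also have "\<dots> \<le> size I * d"
      using I_min few[OF _ d] unfolding q_def[symmetric] by (induction I) (auto simp: add_mono)
    also have "\<dots> \<le> n * d" using I(2) sizeU by simp
    finally show ?thesis .
  qed
  have "real (size W) = real (size Ts)" by (simp add: W(2))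
  also have "\<dots> \<le> (\<Sum>d | d dvd n \<and> 1 < d. level_bound n d)"
    using Ts(3) by (rule order_trans) (intro sum_mono order_bound_le_level_bound level; simp)
  finally show ?thesis using I sizeU V W Ts(2)
    by (intro exI[of _ I] exI[of _ W]) auto
qed

section \<open>The reduced monoid as a monoid of multisets\<close>

lemma sum_repeat_mset_count:
  assumes "finite A" "set_mset Z \<subseteq> A"
  shows "(\<Sum>m\<in>A. repeat_mset (count Z m) m) = \<Sum>\<^sub># Z"
  using assms(2)
proof (induction Z)
  case empty
  thus ?case by simp
next
  case (add x Z)
  have "repeat_mset (count (add_mset x Z) m) m = (if m = x then m else {#}) + repeat_mset (count Z m) m" for m
    by (auto simp: multiset_eq_iff)
  hence "(\<Sum>m\<in>A. repeat_mset (count (add_mset x Z) m) m) =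
      (\<Sum>m\<in>A. if m = x then m else {#}) + (\<Sum>m\<in>A. repeat_mset (count Z m) m)"
    by (simp only: sum.distrib)
  also have "(\<Sum>m\<in>A. if m = x then m else {#}) = x"
    using add.prems assms(1) by (simp add: sum.delta)
  finally show ?case using add by simp
qed

context krull_monoid
begin

text \<open>By \<open>coset_eq_phi_fibre\<close> below, the nonempty fibres of \<open>\<phi>\<close> are the cosets of the group of units.\<close>

definition phi_fibre :: "'p multiset \<Rightarrow> 'a set" where
  "phi_fibre m = {a \<in> carrier H. \<phi> a = m}"

lemma Units_eq_phi_fibre: "Units H = phi_fibre {#}"
proof (intro Set.set_eqI iffI)
  fix a assume a: "a \<in> Units H"
  hence c: "a \<in> carrier H" "inv a \<in> carrier H" by auto
  have "\<phi> (a \<otimes> inv a) = {#}" using a phi_one by simp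
  thus "a \<in> phi_fibre {#}" using phi_mult[OF c] c by (simp add: phi_fibre_def)
next
  fix a assume "a \<in> phi_fibre {#}"
  hence a: "a \<in> carrier H" "\<phi> a = {#}" by (auto simp: phi_fibre_def)
  hence "a divides \<one>" by (intro phi_subset_imp_divides) (auto simp: phi_one)
  thus "a \<in> Units H" using Unit_eq_dividesone[OF a(1)] by simp
qed

text \<open>If \<open>\<phi> b = \<phi> a\<close>, then \<open>a\<close> divides \<open>b\<close> and the quotient has trivial image, so it is a unit.\<close>

lemma coset_eq_phi_fibre:
  assumes "a \<in> carrier H"
  shows "a <# Units H = phi_fibre (\<phi> a)"
proof (intro Set.set_eqI iffI)
  fix b assume "b \<in> a <# Units H"
  then obtain u where u: "u \<in> Units H" "b = a \<otimes> u" by (auto simp: l_coset_def)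
  hence "\<phi> u = {#}" "u \<in> carrier H" by (auto simp: Units_eq_phi_fibre phi_fibre_def)
  thus "b \<in> phi_fibre (\<phi> a)" using u assms by (simp add: phi_fibre_def phi_mult)
next
  fix b assume "b \<in> phi_fibre (\<phi> a)"
  hence b: "b \<in> carrier H" "\<phi> b = \<phi> a" by (auto simp: phi_fibre_def)
  hence "a divides b" using assms by (intro phi_subset_imp_divides) auto
  then obtain c where c: "c \<in> carrier H" "b = a \<otimes> c" by blast
  hence "\<phi> c = {#}" using b assms phi_mult[of a c] by simp
  hence "c \<in> Units H" using c by (simp add: Units_eq_phi_fibre phi_fibre_def)
  thus "b \<in> a <# Units H" using c by (auto simp: l_coset_def)
qed

lemma carrier_reduced: "carrier (reduced_monoid H) = phi_fibre ` \<phi> ` carrier H"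
proof -
  have "carrier (reduced_monoid H) = (\<lambda>a. a <# Units H) ` carrier H"
    by (auto simp: reduced_monoid_def)
  also have "\<dots> = (\<lambda>a. phi_fibre (\<phi> a)) ` carrier H" using coset_eq_phi_fibre by simp
  finally show ?thesis by (simp add: image_image)
qed

lemma one_reduced: "\<one>\<^bsub>reduced_monoid H\<^esub> = phi_fibre {#}"
  by (simp add: reduced_monoid_def Units_eq_phi_fibre)

lemma image_phi_add:
  assumes "m \<in> \<phi> ` carrier H" "m' \<in> \<phi> ` carrier H"
  shows "m + m' \<in> \<phi> ` carrier H"
proof -
  obtain a b where "a \<in> carrier H" "b \<in> carrier H" "m = \<phi> a" "m' = \<phi> b" using assms by blast
  thus ?thesis by (intro image_eqI[of _ _ "a \<otimes> b"]) (auto simp: phi_mult)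
qed

lemma image_phi_zero: "{#} \<in> \<phi> ` carrier H"
  by (rule image_eqI[of _ _ \<one>]) (auto simp: phi_one)

lemma mult_reduced:
  assumes "m \<in> \<phi> ` carrier H" "m' \<in> \<phi> ` carrier H"
  shows "phi_fibre m \<otimes>\<^bsub>reduced_monoid H\<^esub> phi_fibre m' = phi_fibre (m + m')"
proof -
  obtain a b where ab: "a \<in> carrier H" "b \<in> carrier H" "m = \<phi> a" "m' = \<phi> b" using assms by blast
  have "phi_fibre m <#> phi_fibre m' = phi_fibre (m + m')"
  proof (intro Set.set_eqI iffI)
    fix c assume "c \<in> phi_fibre m <#> phi_fibre m'"
    thus "c \<in> phi_fibre (m + m')" by (auto simp: set_mult_def phi_fibre_def phi_mult)
  next
    fix c assume "c \<in> phi_fibre (m + m')"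
    hence c: "c \<in> carrier H" "\<phi> c = \<phi> (a \<otimes> b)" using ab by (auto simp: phi_fibre_def phi_mult)
    hence "c \<in> (a \<otimes> b) <# Units H" using coset_eq_phi_fibre[of "a \<otimes> b"] ab by (simp add: phi_fibre_def)
    then obtain u where u: "u \<in> Units H" "c = a \<otimes> b \<otimes> u" by (auto simp: l_coset_def)
    hence uc: "u \<in> carrier H" "\<phi> u = {#}" by (auto simp: Units_eq_phi_fibre phi_fibre_def)
    hence "c = a \<otimes> (b \<otimes> u)" using u ab by (simp add: m_assoc)
    moreover have "a \<in> phi_fibre m" "b \<otimes> u \<in> phi_fibre m'" using ab uc by (auto simp: phi_fibre_def phi_mult)
    ultimately show "c \<in> phi_fibre m <#> phi_fibre m'" by (auto simp: set_mult_def)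
  qed
  thus ?thesis by (simp add: reduced_monoid_def)
qed

lemma phi_fibre_inject: "m \<in> \<phi> ` carrier H \<Longrightarrow> phi_fibre m = phi_fibre m' \<longleftrightarrow> m = m'"
  by (auto simp: phi_fibre_def)

lemma inj_on_phi_fibre: "inj_on phi_fibre (\<phi> ` carrier H)"
  by (auto intro!: inj_onI simp: phi_fibre_inject)

lemma comm_monoid_reduced: "comm_monoid (reduced_monoid H)"
proof (rule comm_monoidI)
  fix x y assume "x \<in> carrier (reduced_monoid H)" "y \<in> carrier (reduced_monoid H)"
  then obtain m m' where m: "x = phi_fibre m" "y = phi_fibre m'" "m \<in> \<phi> ` carrier H" "m' \<in> \<phi> ` carrier H"
    unfolding carrier_reduced by blast
  show "x \<otimes>\<^bsub>reduced_monoid H\<^esub> y \<in> carrier (reduced_monoid H)"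
    unfolding m(1,2) mult_reduced[OF m(3,4)] carrier_reduced using image_phi_add[OF m(3,4)] by (rule imageI)
  show "x \<otimes>\<^bsub>reduced_monoid H\<^esub> y = y \<otimes>\<^bsub>reduced_monoid H\<^esub> x"
    unfolding m(1,2) mult_reduced[OF m(3,4)] mult_reduced[OF m(4,3)] by (simp add: add.commute)
  fix z assume "z \<in> carrier (reduced_monoid H)"
  then obtain m'' where m'': "z = phi_fibre m''" "m'' \<in> \<phi> ` carrier H" unfolding carrier_reduced by blast
  show "x \<otimes>\<^bsub>reduced_monoid H\<^esub> y \<otimes>\<^bsub>reduced_monoid H\<^esub> z = x \<otimes>\<^bsub>reduced_monoid H\<^esub> (y \<otimes>\<^bsub>reduced_monoid H\<^esub> z)"
    using m m'' by (simp add: mult_reduced image_phi_add add.assoc)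
next
  show "\<one>\<^bsub>reduced_monoid H\<^esub> \<in> carrier (reduced_monoid H)"
    unfolding one_reduced carrier_reduced using image_phi_zero by (rule imageI)
  fix x assume "x \<in> carrier (reduced_monoid H)"
  then obtain m where "x = phi_fibre m" "m \<in> \<phi> ` carrier H" unfolding carrier_reduced by blast
  thus "\<one>\<^bsub>reduced_monoid H\<^esub> \<otimes>\<^bsub>reduced_monoid H\<^esub> x = x"
    by (simp add: one_reduced mult_reduced image_phi_zero)
qed

lemma divides_reduced:
  assumes "m \<in> \<phi> ` carrier H" "m' \<in> \<phi> ` carrier H"
  shows "phi_fibre m divides\<^bsub>reduced_monoid H\<^esub> phi_fibre m' \<longleftrightarrow> m \<subseteq># m'"
proof
  assume "phi_fibre m divides\<^bsub>reduced_monoid H\<^esub> phi_fibre m'"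
  then obtain c where c: "c \<in> \<phi> ` carrier H" "phi_fibre m' = phi_fibre m \<otimes>\<^bsub>reduced_monoid H\<^esub> phi_fibre c"
    unfolding factor_def carrier_reduced by blast
  hence "m' = m + c" using assms by (simp add: mult_reduced phi_fibre_inject)
  thus "m \<subseteq># m'" by simp
next
  assume sub: "m \<subseteq># m'"
  obtain a b where ab: "a \<in> carrier H" "b \<in> carrier H" "m = \<phi> a" "m' = \<phi> b" using assms by blast
  have "(m' - m) + m = \<phi> b" using sub ab(4) by simp
  hence "m' - m \<in> \<phi> ` carrier H" by (rule image_phi_diff[OF _ ab(3,2,1)])
  moreover from this have "phi_fibre m' = phi_fibre m \<otimes>\<^bsub>reduced_monoid H\<^esub> phi_fibre (m' - m)"
    using sub assms by (simp add: mult_reduced)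
  ultimately show "phi_fibre m divides\<^bsub>reduced_monoid H\<^esub> phi_fibre m'"
    unfolding factor_def carrier_reduced by blast
qed

lemma Units_reduced:
  assumes "m \<in> \<phi> ` carrier H"
  shows "phi_fibre m \<in> Units (reduced_monoid H) \<longleftrightarrow> m = {#}"
proof -
  interpret R: comm_monoid "reduced_monoid H" by (rule comm_monoid_reduced)
  have "phi_fibre m \<in> carrier (reduced_monoid H)" unfolding carrier_reduced using assms by (rule imageI)
  hence "phi_fibre m \<in> Units (reduced_monoid H) \<longleftrightarrow> phi_fibre m divides\<^bsub>reduced_monoid H\<^esub> phi_fibre {#}"
    unfolding one_reduced[symmetric] by (rule R.Unit_eq_dividesone)
  also have "\<dots> \<longleftrightarrow> m = {#}" using divides_reduced[OF assms image_phi_zero] by simp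
  finally show ?thesis .
qed

lemma irreducible_reduced:
  assumes "m \<in> \<phi> ` carrier H"
  shows "Divisibility.irreducible (reduced_monoid H) (phi_fibre m) \<longleftrightarrow>
    m \<noteq> {#} \<and> (\<forall>b\<in>\<phi> ` carrier H. b \<subseteq># m \<longrightarrow> b = {#} \<or> b = m)"
proof -
  have "Divisibility.irreducible (reduced_monoid H) (phi_fibre m) \<longleftrightarrow>
      m \<noteq> {#} \<and> (\<forall>b\<in>\<phi> ` carrier H. properfactor (reduced_monoid H) (phi_fibre b) (phi_fibre m) \<longrightarrow>
         phi_fibre b \<in> Units (reduced_monoid H))"
    unfolding Divisibility.irreducible_def carrier_reduced using Units_reduced[OF assms] by auto
  also have "\<dots> \<longleftrightarrow> m \<noteq> {#} \<and> (\<forall>b\<in>\<phi> ` carrier H. b \<subseteq># m \<longrightarrow> b = {#} \<or> b = m)"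
    using divides_reduced[OF _ assms] divides_reduced[OF assms] Units_reduced
    unfolding properfactor_def by (auto dest: subset_mset.antisym)
  finally show ?thesis .
qed

lemma pow_reduced:
  assumes "m \<in> \<phi> ` carrier H"
  shows "phi_fibre m [^]\<^bsub>reduced_monoid H\<^esub> (k::nat) = phi_fibre (repeat_mset k m) \<and> repeat_mset k m \<in> \<phi> ` carrier H"
proof (induction k)
  case 0
  thus ?case using image_phi_zero by (simp add: one_reduced)
next
  case (Suc k)
  have "phi_fibre m [^]\<^bsub>reduced_monoid H\<^esub> Suc k = phi_fibre (repeat_mset k m) \<otimes>\<^bsub>reduced_monoid H\<^esub> phi_fibre m"
    using Suc by (simp add: nat_pow_def)
  also have "\<dots> = phi_fibre (repeat_mset k m + m)" using Suc assms by (intro mult_reduced) auto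
  also have "repeat_mset k m + m = repeat_mset (Suc k) m" by simp
  finally show ?case using image_phi_add[OF _ assms, of "repeat_mset k m"] Suc by (simp add: add.commute)
qed

lemma finprod_reduced:
  assumes "finite A" "A \<subseteq> \<phi> ` carrier H" "\<And>m. m \<in> A \<Longrightarrow> f m \<in> \<phi> ` carrier H"
  shows "(\<Otimes>\<^bsub>reduced_monoid H\<^esub>m\<in>A. phi_fibre (f m)) = phi_fibre (\<Sum>m\<in>A. f m) \<and> (\<Sum>m\<in>A. f m) \<in> \<phi> ` carrier H"
proof -
  interpret R: comm_monoid "reduced_monoid H" by (rule comm_monoid_reduced)
  show ?thesis using assms
  proof (induction A rule: finite_induct)
    case empty
    show ?case using image_phi_zero by (simp add: one_reduced)
  next
    case (insert m A)
    have "(\<lambda>m. phi_fibre (f m)) \<in> A \<rightarrow> carrier (reduced_monoid H)" "phi_fibre (f m) \<in> carrier (reduced_monoid H)"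
      using insert.prems unfolding carrier_reduced by auto
    hence "(\<Otimes>\<^bsub>reduced_monoid H\<^esub>m\<in>insert m A. phi_fibre (f m)) =
        phi_fibre (f m) \<otimes>\<^bsub>reduced_monoid H\<^esub> (\<Otimes>\<^bsub>reduced_monoid H\<^esub>m\<in>A. phi_fibre (f m))"
      using insert.hyps by simp
    thus ?case using insert by (simp add: mult_reduced image_phi_add)
  qed
qed

lemma factorization_hom_phi_fibre:
  assumes "set_mset Z \<subseteq> \<phi> ` carrier H"
  shows "factorization_hom H (image_mset phi_fibre Z) = phi_fibre (\<Sum>\<^sub># Z)"
proof -
  interpret R: comm_monoid "reduced_monoid H" by (rule comm_monoid_reduced)
  have inj: "inj_on phi_fibre (set_mset Z)" using inj_on_phi_fibre assms by (rule inj_on_subset)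
  have cnt: "count (image_mset phi_fibre Z) (phi_fibre m) = count Z m" if "m \<in># Z" for m
  proof -
    have "phi_fibre -` {phi_fibre m} \<inter> set_mset Z = {m}" using that inj by (auto dest: inj_onD)
    thus ?thesis by (simp add: count_image_mset)
  qed
  have pow: "phi_fibre m [^]\<^bsub>reduced_monoid H\<^esub> count (image_mset phi_fibre Z) (phi_fibre m) = phi_fibre (repeat_mset (count Z m) m)"
    "repeat_mset (count Z m) m \<in> \<phi> ` carrier H" if "m \<in># Z" for m
    using pow_reduced[of m] that assms cnt[OF that] by auto
  have "factorization_hom H (image_mset phi_fibre Z) =
      (\<Otimes>\<^bsub>reduced_monoid H\<^esub>u\<in>phi_fibre ` set_mset Z. u [^]\<^bsub>reduced_monoid H\<^esub> count (image_mset phi_fibre Z) u)"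
    by (simp add: factorization_hom_def)
  also have "\<dots> = (\<Otimes>\<^bsub>reduced_monoid H\<^esub>m\<in>set_mset Z.
      phi_fibre m [^]\<^bsub>reduced_monoid H\<^esub> count (image_mset phi_fibre Z) (phi_fibre m))"
  proof (rule R.finprod_reindex[OF _ inj])
    show "(\<lambda>u. u [^]\<^bsub>reduced_monoid H\<^esub> count (image_mset phi_fibre Z) u) \<in> phi_fibre ` set_mset Z \<rightarrow> carrier (reduced_monoid H)"
    proof (rule Pi_I)
      fix u assume "u \<in> phi_fibre ` set_mset Z"
      hence "u \<in> carrier (reduced_monoid H)" using assms unfolding carrier_reduced by blast
      thus "u [^]\<^bsub>reduced_monoid H\<^esub> count (image_mset phi_fibre Z) u \<in> carrier (reduced_monoid H)"
        by (rule R.nat_pow_closed)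
    qed
  qed
  also have "\<dots> = (\<Otimes>\<^bsub>reduced_monoid H\<^esub>m\<in>set_mset Z. phi_fibre (repeat_mset (count Z m) m))"
    using pow by (intro R.finprod_cong') (auto simp: carrier_reduced)
  also have "\<dots> = phi_fibre (\<Sum>m\<in>set_mset Z. repeat_mset (count Z m) m)"
    using finprod_reduced[of "set_mset Z" "\<lambda>m. repeat_mset (count Z m) m"] assms pow(2) by simp
  also have "(\<Sum>m\<in>set_mset Z. repeat_mset (count Z m) m) = \<Sum>\<^sub># Z" by (rule sum_repeat_mset_count) auto
  finally show ?thesis .
qed

end

lemma factorization_distance_common:
  "factorization_distance (c + x) (c + y) \<le> max (size x) (size y)"
proof -
  have "c \<subseteq># (c + x) \<inter># (c + y)" by simp
  hence "(c + x) - (c + x) \<inter># (c + y) \<subseteq># x" "(c + y) - (c + x) \<inter># (c + y) \<subseteq># y"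
    by (auto simp: subseteq_mset_def)
  thus ?thesis unfolding factorization_distance_def by (meson max.mono size_mset_mono)
qed

lemma tame_degree_le:
  assumes "\<And>u a z w. u \<in> atoms (reduced_monoid H) \<Longrightarrow> a \<in> carrier H \<Longrightarrow> z \<in> factorizations H a \<Longrightarrow>
      w \<in> factorizations H a \<Longrightarrow> u \<in># w \<Longrightarrow>
      \<exists>z'\<in>factorizations H a. u \<in># z' \<and> factorization_distance z z' \<le> N"
  shows "tame_degree H \<le> enat N"
  unfolding tame_degree_def atom_tame_degree_def
proof (intro SUP_least)
  fix u a assume ua: "u \<in> atoms (reduced_monoid H)" "a \<in> carrier H"
  let ?M = "factorization_monoid H"
  let ?Zx = "factorizations H a \<inter> ({#u#} <#\<^bsub>?M\<^esub> carrier ?M)"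
  have mem: "z \<in> {#u#} <#\<^bsub>?M\<^esub> carrier ?M \<longleftrightarrow> u \<in># z" if "z \<in> factorizations H a" for z
  proof
    assume "z \<in> {#u#} <#\<^bsub>?M\<^esub> carrier ?M"
    thus "u \<in># z" by (auto simp: l_coset_def factorization_monoid_def free_abelian_monoid_def)
  next
    assume "u \<in># z"
    then obtain y where "z = add_mset u y" by (metis multi_member_split)
    moreover have "set_mset z \<subseteq> atoms (reduced_monoid H)" using that
      by (auto simp: factorizations_def factorization_monoid_def free_abelian_monoid_def)
    ultimately show "z \<in> {#u#} <#\<^bsub>?M\<^esub> carrier ?M"
      by (auto simp: l_coset_def factorization_monoid_def free_abelian_monoid_def)
  qed
  show "local_tame_degree H a {#u#} \<le> enat N"
    unfolding local_tame_degree_def Let_def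
  proof (rule Least_le, intro impI ballI)
    fix z assume ne: "?Zx \<noteq> {}" and z: "z \<in> factorizations H a"
    then obtain w where w: "w \<in> factorizations H a" "u \<in># w" using mem by blast
    obtain z' where "z' \<in> factorizations H a" "u \<in># z'" "factorization_distance z z' \<le> N"
      using assms[OF ua z w] by blast
    thus "\<exists>z'\<in>?Zx. enat (factorization_distance z z') \<le> enat N" using mem by auto
  qed
qed

context krull_monoid
begin

text \<open>The atoms of the reduced monoid are the fibres over the minimal zero-sum multisets of primes, and
  factorizations correspond to multisets of such multisets. A factorization \<open>Z\<close> is changed into
  \<open>(Z - I) + {U} + W\<close> with \<open>I\<close> and \<open>W\<close> from \<open>exchange_factorization\<close>.\<close>

lemma tame_degree_bound:
  assumes "cyclic_group (class_group H P \<phi>)" "order (class_group H P \<phi>) = n" "n \<ge> 2"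
  shows "ereal_of_enat (tame_degree H) \<le> ereal (1 + (\<Sum>d | d dvd n \<and> 1 < d. level_bound n d))"
proof -
  define b where "b = (\<Sum>d | d dvd n \<and> 1 < d. level_bound n d)"
  have bn: "real n \<le> 1 + b" using sum_level_bound_ge[OF assms(3)] by (simp add: b_def)
  obtain \<kappa> :: "'p \<Rightarrow> int" where \<kappa>: "\<And>p. 0 \<le> \<kappa> p \<and> \<kappa> p < int n"
    "\<And>m. set_mset m \<subseteq> P \<Longrightarrow> m \<in> \<phi> ` carrier H \<longleftrightarrow> zero_sum n (image_mset \<kappa> m)"
    using class_function_exists[OF assms(1,2)] assms(3) by auto
  define \<A> where "\<A> = {m. set_mset m \<subseteq> P \<and> minimal_zero_sum n (image_mset \<kappa> m)}"
  have B_P: "set_mset m \<subseteq> P" if "m \<in> \<phi> ` carrier H" for m using that phi_in_P by auto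
  have \<A>B: "\<A> \<subseteq> \<phi> ` carrier H" using \<kappa>(2) by (auto simp: \<A>_def minimal_zero_sum_def)
  have min_iff: "m \<in> \<A> \<longleftrightarrow> m \<noteq> {#} \<and> (\<forall>b\<in>\<phi> ` carrier H. b \<subseteq># m \<longrightarrow> b = {#} \<or> b = m)"
    if m: "m \<in> \<phi> ` carrier H" for m
  proof
    assume mA: "m \<in> \<A>"
    hence min: "minimal_zero_sum n (image_mset \<kappa> m)" by (simp add: \<A>_def)
    show "m \<noteq> {#} \<and> (\<forall>b\<in>\<phi> ` carrier H. b \<subseteq># m \<longrightarrow> b = {#} \<or> b = m)"
    proof (intro conjI ballI impI)
      show "m \<noteq> {#}" using min by (auto simp: minimal_zero_sum_def)
      fix b assume b: "b \<in> \<phi> ` carrier H" "b \<subseteq># m"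
      thus "b = {#} \<or> b = m" using minimal_image_unique[OF min b(2)] \<kappa>(2)[OF B_P[OF b(1)]] by auto
    qed
  next
    assume m_min: "m \<noteq> {#} \<and> (\<forall>b\<in>\<phi> ` carrier H. b \<subseteq># m \<longrightarrow> b = {#} \<or> b = m)"
    have "minimal_zero_sum n (image_mset \<kappa> m)"
      unfolding minimal_zero_sum_def
    proof (intro conjI allI impI)
      fix T assume T: "T \<subseteq># image_mset \<kappa> m" "zero_sum n T"
      then obtain C D where C: "m = C + D" "T = image_mset \<kappa> C"
        using image_mset_eq_plusD[of \<kappa> m T "image_mset \<kappa> m - T"] by auto
      have "C \<in> \<phi> ` carrier H" using \<kappa>(2)[of C] T(2) C B_P[OF m] by auto
      thus "T = {#} \<or> T = image_mset \<kappa> m" using m_min C by (metis image_mset_empty mset_subset_eq_add_left)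
    qed (use m_min m \<kappa>(2)[OF B_P[OF m]] in auto)
    thus "m \<in> \<A>" using B_P[OF m] by (simp add: \<A>_def)
  qed
  have atoms: "atoms (reduced_monoid H) = phi_fibre ` \<A>"
  proof (intro Set.set_eqI iffI)
    fix u assume "u \<in> atoms (reduced_monoid H)"
    hence u: "u \<in> phi_fibre ` \<phi> ` carrier H" "Divisibility.irreducible (reduced_monoid H) u"
      by (simp_all add: atoms_def carrier_reduced)
    then obtain m where m: "u = phi_fibre m" "m \<in> \<phi> ` carrier H" by blast
    hence "m \<in> \<A>" using u(2) irreducible_reduced[OF m(2)] min_iff[OF m(2)] by simp
    thus "u \<in> phi_fibre ` \<A>" using m(1) by blast
  next
    fix u assume "u \<in> phi_fibre ` \<A>"
    then obtain m where m: "u = phi_fibre m" "m \<in> \<A>" by blast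
    hence mB: "m \<in> \<phi> ` carrier H" using \<A>B by blast
    thus "u \<in> atoms (reduced_monoid H)"
      using m irreducible_reduced[OF mB] min_iff[OF mB] by (simp add: atoms_def carrier_reduced)
  qed
  have fact_iff: "image_mset phi_fibre Z \<in> factorizations H a \<longleftrightarrow> \<Sum>\<^sub># Z = \<phi> a"
    if "set_mset Z \<subseteq> \<A>" "a \<in> carrier H" for Z a
  proof -
    have ZB: "set_mset Z \<subseteq> \<phi> ` carrier H" using that(1) \<A>B by blast
    have "phi_fibre (\<phi> a) = phi_fibre (\<Sum>\<^sub># Z) \<longleftrightarrow> \<phi> a = \<Sum>\<^sub># Z"
      by (rule phi_fibre_inject[OF imageI[OF that(2)]])
    hence "phi_fibre (\<Sum>\<^sub># Z) = phi_fibre (\<phi> a) \<longleftrightarrow> \<Sum>\<^sub># Z = \<phi> a" by metis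
    moreover have "image_mset phi_fibre Z \<in> carrier (factorization_monoid H)"
      using that(1) by (auto simp: factorization_monoid_def free_abelian_monoid_def atoms)
    ultimately show ?thesis
      by (simp only: factorizations_def coset_eq_phi_fibre[OF that(2)] factorization_hom_phi_fibre[OF ZB]
          mem_Collect_eq simp_thms)
  qed
  have fact_rep: "\<exists>Z. z = image_mset phi_fibre Z \<and> set_mset Z \<subseteq> \<A>" if "z \<in> factorizations H a" for z a
  proof -
    have "set_mset z \<subseteq> phi_fibre ` \<A>" using that
      by (auto simp: factorizations_def factorization_monoid_def free_abelian_monoid_def atoms)
    thus ?thesis
    proof (induction z)
      case (add x z)
      then obtain Z m where "z = image_mset phi_fibre Z" "set_mset Z \<subseteq> \<A>" "x = phi_fibre m" "m \<in> \<A>" by auto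
      thus ?case by (intro exI[of _ "add_mset m Z"]) auto
    qed auto
  qed
  have "tame_degree H \<le> enat (nat \<lfloor>1 + b\<rfloor>)"
  proof (rule tame_degree_le)
    fix u a z w
    assume u: "u \<in> atoms (reduced_monoid H)" and a: "a \<in> carrier H"
      and z: "z \<in> factorizations H a" and w: "w \<in> factorizations H a" "u \<in># w"
    obtain U where U: "u = phi_fibre U" "U \<in> \<A>" using u atoms by auto
    obtain Z where Z: "z = image_mset phi_fibre Z" "set_mset Z \<subseteq> \<A>" using fact_rep[OF z] by blast
    obtain V where V: "w = image_mset phi_fibre V" "set_mset V \<subseteq> \<A>" using fact_rep[OF w(1)] by blast
    have sums: "\<Sum>\<^sub># Z = \<phi> a" "\<Sum>\<^sub># V = \<phi> a"
      using fact_iff[OF Z(2) a] fact_iff[OF V(2) a] z w Z(1) V(1) by auto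
    have "phi_fibre U \<in> phi_fibre ` set_mset V" using w(2) U(1) V(1) by simp
    then obtain m where "phi_fibre U = phi_fibre m" "m \<in># V" by blast
    hence "U \<in># V" using phi_fibre_inject[of U m] U(2) \<A>B by blast
    hence "U \<subseteq># \<Sum>\<^sub># V" by (metis mset_subset_eq_add_left multi_member_split sum_mset.add_mset)
    hence UZ: "U \<subseteq># \<Sum>\<^sub># Z" using sums by simp
    have Zmin: "\<forall>A\<in>#Z. minimal_zero_sum n (image_mset \<kappa> A)" and Umin: "minimal_zero_sum n (image_mset \<kappa> U)"
      using Z(2) U(2) by (auto simp: \<A>_def)
    obtain I W where IW: "I \<subseteq># Z" "\<Sum>\<^sub># I = U + \<Sum>\<^sub># W" "\<forall>A\<in>#W. minimal_zero_sum n (image_mset \<kappa> A)"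
        "real (size I) \<le> real n" "real (size W) \<le> b"
      using exchange_factorization[OF assms(3) \<kappa>(1) Zmin Umin UZ] unfolding b_def by blast
    define Z' where "Z' = (Z - I) + add_mset U W"
    have split: "\<Sum>\<^sub># Z = \<Sum>\<^sub># (Z - I) + \<Sum>\<^sub># I"
      using IW(1) by (metis subset_mset.diff_add sum_mset.union)
    hence sumZ': "\<Sum>\<^sub># Z' = \<phi> a" using sums(1) by (simp add: Z'_def IW(2))
    have W_P: "set_mset A \<subseteq> P" if "A \<in># W" for A
    proof -
      have "A \<subseteq># \<Sum>\<^sub># W" using that by (metis mset_subset_eq_add_left multi_member_split sum_mset.add_mset)
      hence "A \<subseteq># \<phi> a" unfolding sumZ'[symmetric] Z'_def by (simp add: subset_mset.add_increasing)
      thus ?thesis using phi_in_P[OF a] by (meson order_trans set_mset_mono)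
    qed
    have Z'A: "set_mset Z' \<subseteq> \<A>"
      using Z(2) U(2) IW(3) W_P unfolding Z'_def by (auto simp: \<A>_def dest: in_diffD)
    have "image_mset phi_fibre Z' \<in> factorizations H a" using fact_iff[OF Z'A a] sumZ' by simp
    moreover have "u \<in># image_mset phi_fibre Z'" by (simp add: Z'_def U(1))
    moreover have "factorization_distance z (image_mset phi_fibre Z') \<le> nat \<lfloor>1 + b\<rfloor>"
    proof -
      have "z = image_mset phi_fibre (Z - I) + image_mset phi_fibre I"
        using Z(1) IW(1) by (metis image_mset_union subset_mset.diff_add)
      hence "factorization_distance z (image_mset phi_fibre Z') \<le>
          max (size (image_mset phi_fibre I)) (size (image_mset phi_fibre (add_mset U W)))"
        unfolding Z'_def image_mset_union using factorization_distance_common by metis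
      also have "\<dots> = max (size I) (1 + size W)" by simp
      also have "\<dots> \<le> nat \<lfloor>1 + b\<rfloor>"
      proof -
        have "real (size I) \<le> 1 + b" "real (1 + size W) \<le> 1 + b" using IW(4,5) bn by auto
        thus ?thesis by (simp only: max.bounded_iff le_nat_floor)
      qed
      finally show ?thesis .
    qed
    ultimately show "\<exists>z'\<in>factorizations H a. u \<in># z' \<and> factorization_distance z z' \<le> nat \<lfloor>1 + b\<rfloor>"
      by blast
  qed
  hence "ereal_of_enat (tame_degree H) \<le> ereal_of_enat (enat (nat \<lfloor>1 + b\<rfloor>))"
    by (simp only: ereal_of_enat_le_iff)
  also have "\<dots> \<le> ereal (1 + b)"
  proof -
    have "real (nat \<lfloor>1 + b\<rfloor>) \<le> 1 + b" using bn by (intro of_nat_floor) linarith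
    thus ?thesis by simp
  qed
  finally show ?thesis by (simp add: b_def)
qed

end

theorem theorem5p2:
  fixes H :: "('a, 'b) monoid_scheme" and P :: "'p set" and \<phi> :: "'a \<Rightarrow> 'p multiset"
    and n :: nat
  assumes "krull_monoid H P \<phi>"
    and "cyclic_group (class_group H P \<phi>)"
    and "order (class_group H P \<phi>) = n"
    and "n \<ge> 5"
  shows
    "(Factorial_Ring.prime n \<longrightarrow>
        ereal_of_enat (tame_degree H) \<le>
          ereal (1 + 2 * (real n - 1) * real n / (real n + 5)
                 + 2 * (real n - 1) * (1 / 2 + ln ((real n + 3) / 2))))
     \<and>
     (\<forall>p \<alpha>. Factorial_Ring.prime p \<and> \<alpha> \<ge> 2 \<and> n = p ^ \<alpha> \<longrightarrow>
        ereal_of_enat (tame_degree H) \<le>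
          ereal (1 - 2 * real \<alpha> + 2 * real p ^ (\<alpha> + 1) / (real p - 1) + 2 * real \<alpha> * real n
                 + 3 * (\<Sum>i = 1..\<alpha>. (real p ^ i - 1) * ln (real p ^ i / 2))))
     \<and>
     (\<forall>(r::nat) (p :: nat \<Rightarrow> nat) (\<alpha> :: nat \<Rightarrow> nat).
        r \<ge> 2 \<and> (\<forall>i\<in>{1..r}. Factorial_Ring.prime (p i) \<and> \<alpha> i \<ge> 1) \<and> inj_on p {1..r}
        \<and> n = (\<Prod>i = 1..r. p i ^ \<alpha> i) \<longrightarrow>
        ereal_of_enat (tame_degree H) \<le>
          ereal (1 + 4.3 / 2 * (\<Sum>d | d dvd n \<and> 1 < d. real d - 1)
                 + real n * (\<Sum>d | d dvd n \<and> 1 < d \<and> d \<le> 4375. real d / 2)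
                 + real n * (\<Sum>d | d dvd n \<and> 4376 \<le> d.
                     2 ^ (num_prime_divisors d + 1) * sqrt (2 * real (num_prime_divisors d)))
                 + 3.3 * (\<Sum>d | d dvd n \<and> 4376 \<le> d.
                     (real d - 1) *
                     ln (real_of_int
                       \<lfloor>(real d + 1) / (2 ^ (num_prime_divisors d + 1)
                           * sqrt (2 * real (num_prime_divisors d) - 1) + 1) - 1\<rfloor>))))"
proof -
  interpret krull_monoid H P \<phi> by (rule assms(1))
  have bound: "ereal_of_enat (tame_degree H) \<le> ereal r"
    if "1 + (\<Sum>d | d dvd n \<and> 1 < d. level_bound n d) \<le> r" for r
    using tame_degree_bound[OF assms(2,3)] assms(4) that by (auto intro: order_trans)
  show ?thesis
  proof (intro conjI impI allI bound, goal_cases)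
    case 1
    thus ?case using sum_level_bound_prime[of n] assms(4) by simp
  next
    case (2 p \<alpha>)
    thus ?case using sum_level_bound_prime_power[of p n \<alpha>] by simp
  next
    case 3
    show ?case using sum_level_bound_general[of n] assms(4) by linarith
  qed
qed

end
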